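(* The class $\mathcal F_{\oplus,\otimes}$ of straight-line programs that use only floating-point addition $\oplus$, multiplication $\otimes$, and floating-point constants is floating-point interval-complete: for all $n,m\in\mathbb N$ and every function $P:\mathbb F^n\to(\mathbb F\cup\{-\infty,+\infty\})^m$ (equivalently, every terminating floating-point program taking $n$ finite floats and returning $m$ finite or infinite floats), there exists $Q\in\mathcal F_{\oplus,\otimes}$ with $n$ inputs and $m$ outputs that interval-simulates $P$, i.e., for every abstract box $\mathcal B\in\mathbb I^n$ with $\gamma(\mathcal B)\subseteq\mathbb F^n$, $\gamma(Q^\sharp(\mathcal B))=[\min P(\gamma(\mathcal B)),\max P(\gamma(\mathcal B))]\cap\overline{\mathbb F}$ (min and max taken coordinatewise, the right side being the corresponding product of sets). In particular $Q(\mathbf x)=P(\mathbf x)$ for all $\mathbf x\in\mathbb F^n$.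
   Context: Floating point. Fix integers $E\ge 5$ and $M$ with $2^{E-1}\ge M\ge 3$; let $\mathfrak e_{\min}=-2^{E-1}+2$, $\mathfrak e_{\max}=2^{E-1}-1$. $\mathbb F=\{(-1)^b(s_0.s_1\dots s_M)_2\cdot 2^e: b,s_i\in\{0,1\},e\in\{\mathfrak e_{\min},\dots,\mathfrak e_{\max}\}\}$, $\overline{\mathbb F}=\mathbb F\cup\{-\infty,+\infty,\mathrm{NaN}\}$, $\Omega=2^{\mathfrak e_{\max}}(2-2^{-M})$, $\varepsilon=2^{-M-1}$. $\mathrm{rnd}:\mathbb R\to\overline{\mathbb F}$ is round-to-nearest-ties-to-even (ties toward the float with last significand bit $0$), overflowing to $\pm\infty$ when $|x|\ge\Omega+2^{\mathfrak e_{\max}}\varepsilon$; $x\oplus y=\mathrm{rnd}(x+y)$ and $x\otimes y=\mathrm{rnd}(xy)$ for finite $x,y$, and IEEE-754 semantics for non-finite operands. A straight-line program in $\mathcal F_{\oplus,\otimes}$ with inputs $x_1,\dots,x_n$ is a finite sequence of assignments $v_k:=u\odot u'$, where $\odot\in\{\oplus,\otimes\}$ and each of $u,u'$ is an input, a previously assigned variable, or a constant from $\mathbb F$, together with a designated output tuple of $m$ such terms; its concrete semantics $Q:\mathbb F^n\to\overline{\mathbb F}^m$ is obtained by evaluating the assignments. Intervals: $\mathbb I=\{\langle a,b\rangle:a,b\in\overline{\mathbb F}\setminus\{\mathrm{NaN}\},a\le b\}\cup\{\top\}$, $\gamma(\langle a,b\rangle)=[a,b]\cap\overline{\mathbb F}$,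 $\gamma(\top)=\overline{\mathbb F}$, $\gamma(\mathcal I_1,\dots,\mathcal I_n)=\prod_i\gamma(\mathcal I_i)$. For $\odot\in\{\oplus,\otimes\}$, $\langle a,b\rangle\odot^\sharp\langle c,d\rangle=\langle\min S,\max S\rangle$ with $S=\{a\odot c,a\odot d,b\odot c,b\odot d\}$ if $\mathrm{NaN}\notin S$, and $\top$ if $\mathrm{NaN}\in S$ or either operand is $\top$. The interval semantics $Q^\sharp:\mathbb I^n\to\mathbb I^m$ evaluates the same assignments with $\oplus^\sharp,\otimes^\sharp$ in place of $\oplus,\otimes$ and the singleton interval $\langle c,c\rangle$ in place of each constant $c$. *)

theory Defs
  imports Complex_Main "HOL-Library.Extended_Real"
begin

section \<open>Floating-point format with parameters E (exponent bits) and M (fraction bits)\<close>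

definition emin :: "nat \<Rightarrow> int" where
  "emin E = - (2 ^ (E - 1)) + 2"

definition emax :: "nat \<Rightarrow> int" where
  "emax E = 2 ^ (E - 1) - 1"

text \<open>Finite floats F: (-1)^b (s0.s1...sM)_2 * 2^e, the significand being K / 2^M
  with K = (s0 s1 ... sM)_2 < 2^(M+1). Signed zero is identified with 0 (F is a set of reals).\<close>
definition fl :: "nat \<Rightarrow> nat \<Rightarrow> real set" where
  "fl E M = {(-1) ^ (if b then 1 else 0) * (real K / 2 ^ M) * 2 powr real_of_int e | b K e.
              K < 2 ^ (M + 1) \<and> emin E \<le> e \<and> e \<le> emax E}"

definition fl_even :: "nat \<Rightarrow> nat \<Rightarrow> real \<Rightarrow> bool" where
  "fl_even E M f = (\<exists>b K e. f = (-1) ^ (if b then 1 else 0) * (real K / 2 ^ M) * 2 powr real_of_int e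
              \<and> K < 2 ^ (M + 1) \<and> even K \<and> emin E \<le> e \<and> e \<le> emax E)"

definition Omega :: "nat \<Rightarrow> nat \<Rightarrow> real" where
  "Omega E M = 2 powr real_of_int (emax E) * (2 - 2 powr (- real M))"

definition eps :: "nat \<Rightarrow> real" where
  "eps M = 2 powr (- real M - 1)"

definition flx :: "nat \<Rightarrow> nat \<Rightarrow> ereal set" where
  "flx E M = ereal ` fl E M \<union> {\<infinity>, -\<infinity>}"

datatype fval = Val ereal | NaN

definition Fbar :: "nat \<Rightarrow> nat \<Rightarrow> fval set" where
  "Fbar E M = Val ` flx E M \<union> {NaN}"

definition nearest :: "nat \<Rightarrow> nat \<Rightarrow> real \<Rightarrow> real set" where
  "nearest E M x = {f \<in> fl E M. \<forall>g \<in> fl E M. \<bar>f - x\<bar> \<le> \<bar>g - x\<bar>}"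

definition rnd :: "nat \<Rightarrow> nat \<Rightarrow> real \<Rightarrow> fval" where
  "rnd E M x =
    (if \<bar>x\<bar> \<ge> Omega E M + 2 powr real_of_int (emax E) * eps M
     then Val (if x > 0 then \<infinity> else -\<infinity>)
     else Val (ereal (THE f. f \<in> nearest E M x \<and> (\<forall>g \<in> nearest E M x. g \<noteq> f \<longrightarrow> fl_even E M f))))"

fun fadd :: "nat \<Rightarrow> nat \<Rightarrow> fval \<Rightarrow> fval \<Rightarrow> fval" where
  "fadd E M (Val (ereal a)) (Val (ereal b)) = rnd E M (a + b)"
| "fadd E M (Val a) (Val b) =
     (if (a = \<infinity> \<and> b = -\<infinity>) \<or> (a = -\<infinity> \<and> b = \<infinity>) then NaN else Val (a + b))"
| "fadd E M _ _ = NaN"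

fun fmul :: "nat \<Rightarrow> nat \<Rightarrow> fval \<Rightarrow> fval \<Rightarrow> fval" where
  "fmul E M (Val (ereal a)) (Val (ereal b)) = rnd E M (a * b)"
| "fmul E M (Val a) (Val b) = (if a = 0 \<or> b = 0 then NaN else Val (a * b))"
| "fmul E M _ _ = NaN"

datatype opr = Add | Mul
datatype arg = In nat | V nat | C real
type_synonym instr = "opr \<times> arg \<times> arg"
type_synonym prog = "instr list \<times> arg list"

fun arg_ok :: "nat \<Rightarrow> nat \<Rightarrow> nat \<Rightarrow> nat \<Rightarrow> arg \<Rightarrow> bool" where
  "arg_ok E M n k (In i) = (i < n)"
| "arg_ok E M n k (V j) = (j < k)"
| "arg_ok E M n k (C r) = (r \<in> fl E M)"

definition wf_prog :: "nat \<Rightarrow> nat \<Rightarrow> nat \<Rightarrow> nat \<Rightarrow> prog \<Rightarrow> bool" where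
  "wf_prog E M n m p =
    ((\<forall>k < length (fst p). case fst p ! k of (f, u, u') \<Rightarrow> arg_ok E M n k u \<and> arg_ok E M n k u')
     \<and> length (snd p) = m \<and> (\<forall>u \<in> set (snd p). arg_ok E M n (length (fst p)) u))"

fun argv :: "(real \<Rightarrow> 'v) \<Rightarrow> 'v list \<Rightarrow> 'v list \<Rightarrow> arg \<Rightarrow> 'v" where
  "argv cf xs vs (In i) = xs ! i"
| "argv cf xs vs (V j) = vs ! j"
| "argv cf xs vs (C r) = cf r"

definition run :: "(opr \<Rightarrow> 'v \<Rightarrow> 'v \<Rightarrow> 'v) \<Rightarrow> (real \<Rightarrow> 'v) \<Rightarrow> prog \<Rightarrow> 'v list \<Rightarrow> 'v list" where
  "run opf cf p xs =
    (let vs = foldl (\<lambda>vs (f, u, u'). vs @ [opf f (argv cf xs vs u) (argv cf xs vs u')]) [] (fst p)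
     in map (argv cf xs vs) (snd p))"

definition fop :: "nat \<Rightarrow> nat \<Rightarrow> opr \<Rightarrow> fval \<Rightarrow> fval \<Rightarrow> fval" where
  "fop E M f = (case f of Add \<Rightarrow> fadd E M | Mul \<Rightarrow> fmul E M)"

definition Qc :: "nat \<Rightarrow> nat \<Rightarrow> prog \<Rightarrow> real list \<Rightarrow> fval list" where
  "Qc E M p xs = run (fop E M) (\<lambda>c. Val (ereal c)) p (map (\<lambda>x. Val (ereal x)) xs)"

datatype itv = Itv ereal ereal | Top

definition itvs :: "nat \<Rightarrow> nat \<Rightarrow> itv set" where
  "itvs E M = {Top} \<union> {Itv a b | a b. a \<in> flx E M \<and> b \<in> flx E M \<and> a \<le> b}"

fun gamma :: "nat \<Rightarrow> nat \<Rightarrow> itv \<Rightarrow> fval set" where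
  "gamma E M (Itv a b) = {Val r | r. r \<in> flx E M \<and> a \<le> r \<and> r \<le> b}"
| "gamma E M Top = Fbar E M"

fun iop :: "(fval \<Rightarrow> fval \<Rightarrow> fval) \<Rightarrow> itv \<Rightarrow> itv \<Rightarrow> itv" where
  "iop g (Itv a b) (Itv c d) =
     (let S = {g (Val a) (Val c), g (Val a) (Val d), g (Val b) (Val c), g (Val b) (Val d)}
      in if NaN \<in> S then Top else Itv (Min {r. Val r \<in> S}) (Max {r. Val r \<in> S}))"
| "iop g _ _ = Top"

definition Qa :: "nat \<Rightarrow> nat \<Rightarrow> prog \<Rightarrow> itv list \<Rightarrow> itv list" where
  "Qa E M p B = run (\<lambda>f. iop (fop E M f)) (\<lambda>c. Itv (ereal c) (ereal c)) p B"

end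

theory Submission
  imports Defs
begin

text \<open>The programs are built from operations that are monotone in each operand and stay finite,
  so their interval semantics is exact endpoint evaluation. Multiplication by \<open>5/8\<close>, iterated, sends
  every float \<open>y\<close> to \<open>sgn y * w\<close> with \<open>w\<close> the smallest positive float; applied to \<open>x \<ominus> c\<close> it gives
  threshold indicators with values in \<open>{0, w}\<close>, on which \<open>(a \<oplus> b) \<otimes> 5/8\<close> is disjunction and
  \<open>(a \<oplus> b) \<otimes> 3/8\<close> is conjunction. The disjunction of the indicators of all boxes inside
  \<open>{x. v \<le> P x}\<close> evaluates on a box \<open>B\<close> to an interval whose lower end tells whether \<open>v \<le> Min P B\<close>
  and whose upper end tells whether \<open>v \<le> Max P B\<close>. Summing over consecutive floats \<open>u < v\<close> these
  indicators scaled to \<open>v - u\<close>, a power of two, recovers \<open>P\<close> without rounding error.\<close>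

section \<open>The set of floats\<close>

locale float_format =
  fixes E M :: nat
  assumes E_ge: "E \<ge> 5" and M_ge: "M \<ge> 3" and M_le: "M \<le> 2 ^ (E - 1)"
begin

abbreviation F :: "real set" where "F \<equiv> fl E M"

text \<open>Moving the binary point \<open>M\<close> places makes significands integers: floats
  become \<open>J * 2 powi q\<close> with \<open>q\<close> between \<open>qmin\<close> and
  \<open>qmax\<close>, and \<open>2 powi q\<close> is the spacing at exponent
  \<open>q\<close>.\<close>

definition qmin :: int where "qmin = emin E - int M"
definition qmax :: int where "qmax = emax E - int M"

lemma emax_ge: "emax E \<ge> 15"
proof -
  have "(2::int) ^ 4 \<le> 2 ^ (E - 1)" using E_ge by (intro power_increasing) auto
  then show ?thesis by (simp add: emax_def)
qed

lemma emin_eq: "emin E = 1 - emax E"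
  by (simp add: emin_def emax_def)

text \<open>The bound \<open>M \<le> 2 ^ (E - 1)\<close> keeps the spacing of the largest floats at
  \<open>1/2\<close> or more. Hence \<open>1/2\<close>, \<open>1\<close> and \<open>2\<close> can be
  written with exponent \<open>-1\<close>, and the margin between the largest float and overflow
  exceeds the smallest normal floats.\<close>

lemma qmax_ge: "qmax \<ge> -1"
proof -
  have "int M \<le> int (2 ^ (E - 1))" using M_le by (simp only: of_nat_le_iff)
  then show ?thesis by (simp add: qmax_def emax_def)
qed

lemma qmin_le: "qmin \<le> -17" "qmin < qmax"
  using emax_ge emin_eq M_ge by (auto simp: qmin_def qmax_def)

lemma powi_split: "a \<le> b \<Longrightarrow> (2::real) powi b = 2 ^ nat (b - a) * 2 powi a"
  by (simp flip: power_int_of_nat power_int_add)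

lemma powi_not_neg [simp]: "\<not> (2::real) powi q \<le> 0" "\<not> (2::real) powi q < 0"
  by (simp_all add: not_le not_less)

text \<open>The predicate \<open>R\<close> on significands lets one translation serve both
  \<open>fl\<close> and \<open>fl_even\<close>.\<close>

lemma signed_repr_iff:
  "(\<exists>b K e. x = (-1) ^ (if b then 1 else 0) * (real K / 2 ^ M) * 2 powr real_of_int e
      \<and> K < 2 ^ (M + 1) \<and> R K \<and> emin E \<le> e \<and> e \<le> emax E) \<longleftrightarrow>
   (\<exists>J q. x = of_int J * 2 powi q \<and> \<bar>J\<bar> < 2 ^ (M + 1) \<and> R (nat \<bar>J\<bar>) \<and> qmin \<le> q \<and> q \<le> qmax)"
proof
  assume "\<exists>b K e. x = (-1) ^ (if b then 1 else 0) * (real K / 2 ^ M) * 2 powr real_of_int e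
      \<and> K < 2 ^ (M + 1) \<and> R K \<and> emin E \<le> e \<and> e \<le> emax E"
  then obtain b K e where x: "x = (-1) ^ (if b then 1 else 0) * (real K / 2 ^ M) * 2 powr real_of_int e"
    and K: "K < 2 ^ (M + 1)" "R K" and e: "emin E \<le> e" "e \<le> emax E" by blast
  have "x = of_int (if b then - int K else int K) * 2 powi (e - int M)"
    using x by (simp add: power_int_diff powr_real_of_int')
  moreover have "int K < 2 ^ (M + 1)"
    using K(1) by (metis of_nat_less_iff of_nat_numeral of_nat_power)
  ultimately show "\<exists>J q. x = of_int J * 2 powi q \<and> \<bar>J\<bar> < 2 ^ (M + 1) \<and> R (nat \<bar>J\<bar>) \<and> qmin \<le> q \<and> q \<le> qmax"
    using e K(2)
    by (intro exI[of _ "if b then - int K else int K"] exI[of _ "e - int M"])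
       (auto simp: qmin_def qmax_def)
next
  assume "\<exists>J q. x = of_int J * 2 powi q \<and> \<bar>J\<bar> < 2 ^ (M + 1) \<and> R (nat \<bar>J\<bar>) \<and> qmin \<le> q \<and> q \<le> qmax"
  then obtain J q where x: "x = of_int J * 2 powi q" and J: "\<bar>J\<bar> < 2 ^ (M + 1)" "R (nat \<bar>J\<bar>)"
    and q: "qmin \<le> q" "q \<le> qmax" by blast
  have "x = (-1) ^ (if J < 0 then 1 else 0) * (real (nat \<bar>J\<bar>) / 2 ^ M) * 2 powr real_of_int (q + int M)"
    using x by (simp add: power_int_add powr_real_of_int' del: of_int_add)
  moreover have "nat \<bar>J\<bar> < 2 ^ (M + 1)" using J by (simp add: nat_less_iff)
  ultimately show "\<exists>b K e. x = (-1) ^ (if b then 1 else 0) * (real K / 2 ^ M) * 2 powr real_of_int e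
      \<and> K < 2 ^ (M + 1) \<and> R K \<and> emin E \<le> e \<and> e \<le> emax E"
    using q J(2) unfolding qmin_def qmax_def
    by (intro exI[of _ "J < 0"] exI[of _ "nat \<bar>J\<bar>"] exI[of _ "q + int M"]) auto
qed

lemma fl_iff:
  "x \<in> F \<longleftrightarrow> (\<exists>J q. x = of_int J * 2 powi q \<and> \<bar>J\<bar> < 2 ^ (M + 1) \<and> qmin \<le> q \<and> q \<le> qmax)"
  using signed_repr_iff[of x "\<lambda>_. True"] by (simp add: fl_def)

lemma fl_even_iff:
  "fl_even E M x \<longleftrightarrow>
    (\<exists>J q. x = of_int J * 2 powi q \<and> \<bar>J\<bar> < 2 ^ (M + 1) \<and> even J \<and> qmin \<le> q \<and> q \<le> qmax)"
  using signed_repr_iff[of x even] by (simp add: fl_even_def even_nat_iff)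

lemma fl_I:
  "\<bar>J\<bar> < 2 ^ (M + 1) \<Longrightarrow> qmin \<le> q \<Longrightarrow> q \<le> qmax \<Longrightarrow> of_int J * 2 powi q \<in> F"
  unfolding fl_iff by blast

lemma fl_uminus [simp]: "- x \<in> F \<longleftrightarrow> x \<in> F"
proof -
  have "- x \<in> F" if "x \<in> F" for x
    using that unfolding fl_iff by (metis abs_minus mult_minus_left of_int_minus)
  from this[of x] this[of "- x"] show ?thesis by auto
qed

lemma fl_even_uminus [simp]: "fl_even E M (- x) \<longleftrightarrow> fl_even E M x"
proof -
  have "fl_even E M (- x)" if "fl_even E M x" for x
  proof -
    from that obtain J q where "x = of_int J * 2 powi q" "\<bar>J\<bar> < 2 ^ (M + 1)" "even J" "qmin \<le> q" "q \<le> qmax"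
      unfolding fl_even_iff by blast
    then show ?thesis unfolding fl_even_iff by (intro exI[of _ "- J"] exI[of _ q]) auto
  qed
  from this[of x] this[of "- x"] show ?thesis by auto
qed

lemma finite_fl: "finite F"
proof -
  have "F \<subseteq> (\<lambda>(J, q). of_int J * 2 powi q) ` ({- (2 ^ (M + 1))..2 ^ (M + 1)} \<times> {qmin..qmax})"
    unfolding fl_iff subset_iff by (force simp: image_iff)
  then show ?thesis by (rule finite_subset) auto
qed

text \<open>Since \<open>M \<ge> 3\<close> there are at least four significand bits, enough for the
  constants \<open>5/8\<close> and \<open>3/8\<close>.\<close>

lemma small_int_fl:
  assumes "\<bar>J\<bar> < 2 ^ 4" "qmin \<le> q" "q \<le> qmax" shows "of_int J * 2 powi q \<in> F"
proof -
  have "(2::int) ^ 4 \<le> 2 ^ (M + 1)" using M_ge by (intro power_increasing) auto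
  then show ?thesis using assms by (intro fl_I) auto
qed

lemma zero_fl [simp]: "0 \<in> F"
  using small_int_fl[of 0 qmin] qmin_le by simp

lemma pow2_fl:
  assumes "qmin \<le> k" "k \<le> emax E" shows "2 powi k \<in> F"
proof (cases "k \<le> qmax")
  case True then show ?thesis using small_int_fl[of 1 k] assms by simp
next
  case False
  \<comment> \<open>Above \<open>qmax\<close> the excess moves into the significand, which has room
    for \<open>M\<close> doublings of \<open>1\<close>.\<close>
  have "of_int (2 ^ nat (k - qmax)) * 2 powi qmax \<in> F"
    using False assms qmin_le by (intro fl_I) (auto simp flip: power_Suc intro!: power_strict_increasing simp: qmax_def)
  moreover have "of_int (2 ^ nat (k - qmax)) * 2 powi qmax = (2 powi k :: real)"
    using False powi_split[of qmax k] by simp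
  ultimately show ?thesis by simp
qed

text \<open>\<open>J\<close> is the significand of the normalized representation when \<open>2 ^ M \<le> \<bar>J\<bar>\<close>; subnormals
  have \<open>q = qmin\<close>.\<close>
lemma fl_canonical:
  assumes "x \<in> F"
  obtains J q where "x = of_int J * 2 powi q" "\<bar>J\<bar> < 2 ^ (M + 1)" "qmin \<le> q" "q \<le> qmax"
    "2 ^ M \<le> \<bar>J\<bar> \<or> q = qmin"
proof -
  have "\<exists>J q. x = of_int J * 2 powi q \<and> \<bar>J\<bar> < 2 ^ (M + 1) \<and> qmin \<le> q \<and> q \<le> qmax
          \<and> (2 ^ M \<le> \<bar>J\<bar> \<or> q = qmin)"
    if "x = of_int J * 2 powi q" "\<bar>J\<bar> < 2 ^ (M + 1)" "qmin \<le> q" "q \<le> qmax" for J q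
    using that
  proof (induction "nat (q - qmin)" arbitrary: J q)
    case 0 then show ?case by (intro exI[of _ J] exI[of _ q]) auto
  next
    case (Suc k)
    show ?case
    proof (cases "2 ^ M \<le> \<bar>J\<bar>")
      case True then show ?thesis using Suc.prems by blast
    next
      case False
      have "x = of_int (2 * J) * 2 powi (q - 1)"
        using Suc.prems(1) by (simp add: power_int_diff)
      then show ?thesis using Suc False by (intro Suc.hyps(1)[of "q - 1" "2 * J"]) auto
    qed
  qed
  then show ?thesis using assms that unfolding fl_iff by blast
qed

lemma pow_le_cancel: "(2::real) powi a < 2 powi b \<Longrightarrow> a < b"
  by (meson linorder_not_le one_le_numeral power_int_increasing)

text \<open>With an exponent below \<open>q\<close>, the significand bound would force
  \<open>\<bar>x\<bar> < 2 powi (int M + q)\<close>. So any representation of \<open>x\<close> has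
  exponent at least \<open>q\<close>, and the surplus power of two is absorbed by the
  integer.\<close>

lemma fl_multiple:
  assumes "x \<in> F" "2 powi (int M + q) \<le> \<bar>x\<bar> \<or> q \<le> qmin"
  obtains J where "x = of_int J * 2 powi q"
proof -
  from assms(1) obtain J p where x: "x = of_int J * 2 powi p" and J: "\<bar>J\<bar> < 2 ^ (M + 1)" 
    and p: "qmin \<le> p" unfolding fl_iff by auto
  have "q \<le> p"
  proof (rule ccontr)
    assume "\<not> q \<le> p"
    then have "2 powi (int M + q) \<le> \<bar>x\<bar>" using assms p by auto
    also have "\<bar>x\<bar> = of_int \<bar>J\<bar> * 2 powi p" by (simp add: x abs_mult)
    also have "\<dots> < 2 ^ (M + 1) * 2 powi p"
      using J by (intro mult_strict_right_mono)
         (metis of_int_less_iff of_int_numeral of_int_power, simp)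
    also have "\<dots> = 2 powi (int M + (p + 1))" by (simp add: power_int_add)
    finally show False using pow_le_cancel \<open>\<not> q \<le> p\<close> by fastforce
  qed
  then have "x = of_int (J * 2 ^ nat (p - q)) * 2 powi q"
    using x powi_split[of q p] by simp
  then show ?thesis using that by blast
qed

text \<open>\<open>fl_even\<close> accepts any even representation. One with a smaller exponent
  would double a significand that already has its full \<open>M + 1\<close> bits; one with a larger
  or equal exponent makes \<open>J\<close> a multiple of its even significand.\<close>

lemma fl_even_canonical:
  assumes "x = of_int J * 2 powi q" "\<bar>J\<bar> < 2 ^ (M + 1)" "qmin \<le> q" "q \<le> qmax"
    "2 ^ M \<le> \<bar>J\<bar> \<or> q = qmin"
  shows "fl_even E M x \<longleftrightarrow> even J"
proof
  assume "even J" then show "fl_even E M x" using assms unfolding fl_even_iff by blast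
next
  assume "fl_even E M x"
  then obtain J' p where x: "x = of_int J' * 2 powi p" and J': "\<bar>J'\<bar> < 2 ^ (M + 1)" "even J'"
    and p: "qmin \<le> p" unfolding fl_even_iff by auto
  show "even J"
  proof (cases "q \<le> p")
    case True
    then have "of_int J * (2::real) powi q = of_int (J' * 2 ^ nat (p - q)) * 2 powi q"
      using x assms(1) powi_split[of q p] by simp
    then have "J = J' * 2 ^ nat (p - q)" 
      by (metis mult_cancel_right of_int_eq_iff power_int_not_zero zero_neq_numeral)
    then show ?thesis using J' by simp
  next
    case False
    then have "of_int J' * (2::real) powi p = of_int (J * 2 ^ nat (q - p)) * 2 powi p"
      using x assms(1) powi_split[of p q] by simp
    then have eq: "J' = J * 2 ^ nat (q - p)" 
      by (metis mult_cancel_right of_int_eq_iff power_int_not_zero zero_neq_numeral)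
    have "2 ^ M \<le> \<bar>J\<bar>" using assms(5) False p by auto
    moreover have "(2::int) ^ 1 \<le> 2 ^ nat (q - p)" using False by (intro power_increasing) auto
    ultimately have "2 ^ M * 2 ^ 1 \<le> \<bar>J\<bar> * 2 ^ nat (q - p)" by (intro mult_mono) auto
    then show ?thesis using J' eq by (simp add: abs_mult)
  qed
qed

section \<open>The largest float and neighbouring floats\<close>

definition Om :: real where "Om = of_int (2 ^ (M + 1) - 1) * 2 powi qmax"

lemma Om_fl: "Om \<in> F"
  unfolding Om_def using qmin_le by (intro fl_I) auto

lemma fl_le_Om:
  assumes "x \<in> F" shows "\<bar>x\<bar> \<le> Om"
proof -
  from assms obtain J p where x: "x = of_int J * 2 powi p" and J: "\<bar>J\<bar> < 2 ^ (M + 1)" 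
    and p: "p \<le> qmax" unfolding fl_iff by auto
  have "\<bar>x\<bar> = of_int \<bar>J\<bar> * 2 powi p" by (simp add: x abs_mult)
  also have "\<dots> \<le> of_int (2 ^ (M + 1) - 1) * 2 powi qmax"
    using J p by (intro mult_mono power_int_increasing) (auto simp del: of_int_diff of_int_power)
  finally show ?thesis by (simp add: Om_def)
qed

text \<open>In canonical form the successor of \<open>J * 2 powi q\<close> is
  \<open>(J + 1) * 2 powi q\<close>. Power-of-two gaps allow \<open>P\<close> to be rebuilt exactly;
  alternating parity makes ties-to-even well defined.\<close>

lemma fl_adjacent_nonneg:
  assumes "u \<in> F" "v \<in> F" "0 \<le> u" "u < v" and gap: "\<And>f. f \<in> F \<Longrightarrow> u < f \<Longrightarrow> v \<le> f"
  shows "\<exists>q. qmin \<le> q \<and> q \<le> qmax \<and> v = u + 2 powi q \<and> (fl_even E M u \<longleftrightarrow> \<not> fl_even E M v)"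
proof -
  obtain J q where J: "u = of_int J * 2 powi q" "\<bar>J\<bar> < 2 ^ (M + 1)" "qmin \<le> q" "q \<le> qmax"
    "2 ^ M \<le> \<bar>J\<bar> \<or> q = qmin" using fl_canonical[OF assms(1)] by metis
  have J0: "0 \<le> J" using J(1) assms(3) by (auto simp: zero_le_mult_iff)
  let ?w = "of_int (J + 1) * 2 powi q :: real"
  have uw: "u < ?w" using J(1) by simp
  have w: "?w \<in> F \<and> (fl_even E M ?w \<longleftrightarrow> even (J + 1))"
  proof (cases "J + 1 = 2 ^ (M + 1)")
    case False
    then have *: "\<bar>J + 1\<bar> < 2 ^ (M + 1)" using J J0 by auto
    moreover have "fl_even E M ?w \<longleftrightarrow> even (J + 1)"
      using J J0 * by (intro fl_even_canonical[OF refl, of "J + 1" q]) auto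
    ultimately show ?thesis using J by (auto intro!: fl_I simp del: of_int_add)
  next
    \<comment> \<open>The significand overflows at a binade boundary: the successor is renormalized
      to \<open>2 ^ M\<close> with exponent \<open>q + 1\<close>, still even like
      \<open>J + 1\<close>. At \<open>qmax\<close> this would mean that \<open>u\<close> is
      \<open>Om\<close>, which has no successor.\<close>
    case True
    have "q < qmax"
    proof (rule ccontr)
      assume "\<not> q < qmax"
      moreover have "J = 2 ^ (M + 1) - 1" using True by linarith
      ultimately have "u = Om" using J unfolding Om_def by (metis order_antisym not_less)
      then show False using fl_le_Om[OF assms(2)] assms(4) by auto
    qed
    have weq: "?w = of_int (2 ^ M) * 2 powi (q + 1)"
      unfolding True by (simp add: power_int_add)
    have "?w \<in> F" unfolding weq using \<open>q < qmax\<close> J by (intro fl_I) auto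
    moreover have "fl_even E M ?w" unfolding weq fl_even_iff using \<open>q < qmax\<close> J M_ge
      by (intro exI[of _ "2 ^ M"] exI[of _ "q + 1"]) auto
    ultimately show ?thesis using True by simp
  qed
  have "v \<le> ?w" using gap w uw by blast
  \<comment> \<open>As \<open>v\<close> is larger than \<open>u\<close>, it too is a multiple of
    \<open>2 powi q\<close>, which leaves no float strictly between \<open>u\<close> and
    \<open>?w\<close>.\<close>
  have "2 powi (int M + q) \<le> \<bar>v\<bar> \<or> q \<le> qmin"
  proof (cases "q = qmin")
    case False
    then have "2 ^ M \<le> J" using J(5) J0 by simp
    then have "of_int (2 ^ M) \<le> (of_int J :: real)" by (simp only: of_int_le_iff)
    then have "2 ^ M * 2 powi q \<le> u" unfolding J(1) by (intro mult_right_mono) auto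
    then show ?thesis using assms by (simp add: power_int_add)
  qed auto
  then obtain K where K: "v = of_int K * 2 powi q" using fl_multiple[OF assms(2)] by metis
  have "J < K" using assms(4) unfolding K J(1) by (simp add: mult_less_cancel_right)
  moreover have "K \<le> J + 1" using \<open>v \<le> ?w\<close> unfolding K by (simp add: mult_le_cancel_right del: of_int_add)
  ultimately have "v = ?w" using K by (simp add: add1_zle_eq order_antisym)
  moreover have "fl_even E M u \<longleftrightarrow> even J" using J fl_even_canonical by blast
  ultimately show ?thesis using w J by (intro exI[of _ q]) (auto simp: algebra_simps)
qed

lemma fl_adjacent:
  assumes "u \<in> F" "v \<in> F" "u < v" and gap: "\<And>f. f \<in> F \<Longrightarrow> u < f \<Longrightarrow> v \<le> f"
  shows "\<exists>q. qmin \<le> q \<and> q \<le> qmax \<and> v = u + 2 powi q \<and> (fl_even E M u \<longleftrightarrow> \<not> fl_even E M v)"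
proof (cases "0 \<le> u")
  case True then show ?thesis using fl_adjacent_nonneg assms by blast
next
  case False
  \<comment> \<open>Because \<open>0\<close> is a float, the pair cannot straddle it; its mirror
    image is an adjacent nonnegative pair.\<close>
  then have "v \<le> 0" using gap[of 0] by simp
  have "\<exists>q\<ge>qmin. q \<le> qmax \<and> - u = - v + 2 powi q \<and> (fl_even E M (- v) \<longleftrightarrow> \<not> fl_even E M (- u))"
  proof (rule fl_adjacent_nonneg)
    fix f assume "f \<in> F" "- v < f"
    then show "- u \<le> f" using gap[of "- f"] by force
  qed (use assms \<open>v \<le> 0\<close> in auto)
  then obtain q where "qmin \<le> q" "q \<le> qmax" "- u = - v + 2 powi q" "fl_even E M v \<longleftrightarrow> \<not> fl_even E M u"
    unfolding fl_even_uminus by blast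
  moreover from this have "v = u + 2 powi q" by linarith
  ultimately show ?thesis by blast
qed

section \<open>Rounding\<close>


text \<open>Rounding without the overflow branch, hence always a finite float; \<open>rdx\<close>
  puts overflow back.\<close>

definition rd :: "real \<Rightarrow> real" where
  "rd x = (THE f. f \<in> nearest E M x \<and> (\<forall>g \<in> nearest E M x. g \<noteq> f \<longrightarrow> fl_even E M f))"

lemma nearest_nonempty: "\<exists>f. f \<in> nearest E M x"
proof -
  have "F \<noteq> {}" using zero_fl by blast
  then obtain f where "f \<in> F" "\<forall>g \<in> F. \<bar>f - x\<bar> \<le> \<bar>g - x\<bar>"
    using ex_is_arg_min_if_finite[OF finite_fl, of "\<lambda>f. \<bar>f - x\<bar>"]
    unfolding is_arg_min_linorder by blast
  then show ?thesis by (auto simp: nearest_def)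
qed

text \<open>Two nearest floats lie symmetrically about \<open>x\<close>, and a float between them
  would be nearer. They are therefore adjacent and of opposite parity, so the tie rule selects
  exactly one.\<close>

lemma nearest_pair:
  assumes u: "u \<in> nearest E M x" and v: "v \<in> nearest E M x" and "u < v"
  shows "nearest E M x = {u, v}" "fl_even E M u \<longleftrightarrow> \<not> fl_even E M v"
proof -
  have uv: "u \<in> F" "v \<in> F" and le: "\<And>g. g \<in> F \<Longrightarrow> \<bar>u - x\<bar> \<le> \<bar>g - x\<bar>"
    using u v by (auto simp: nearest_def)
  have eq: "\<bar>g - x\<bar> = \<bar>u - x\<bar>" if "g \<in> nearest E M x" for g
    using that u by (simp add: nearest_def order_antisym)
  have x: "x - u = v - x" using eq[OF v] assms(3) by linarith
  have "g = u \<or> g = v" if "g \<in> nearest E M x" for g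
    using eq[OF that] x by linarith
  then show "nearest E M x = {u, v}" using u v by blast
  show "fl_even E M u \<longleftrightarrow> \<not> fl_even E M v"
  proof -
    have "v \<le> f" if "f \<in> F" "u < f" for f
      using le[OF that(1)] that(2) x by linarith
    then show ?thesis using fl_adjacent[OF uv assms(3)] by blast
  qed
qed

lemma rd_unique: "\<exists>!f. f \<in> nearest E M x \<and> (\<forall>g \<in> nearest E M x. g \<noteq> f \<longrightarrow> fl_even E M f)"
proof (cases "\<exists>u v. u \<in> nearest E M x \<and> v \<in> nearest E M x \<and> u < v")
  case True
  then obtain u v where *: "u \<in> nearest E M x" "v \<in> nearest E M x" "u < v" by blast
  show ?thesis using nearest_pair[OF *] *(3) by (cases "fl_even E M u") auto
next
  case False
  obtain f where "f \<in> nearest E M x" using nearest_nonempty by blast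
  then have "nearest E M x = {f}" using False by (metis is_singletonI' is_singleton_the_elem linorder_neqE_linordered_idom
      singletonD empty_iff)
  then show ?thesis by auto
qed

lemma rd_nearest: "rd x \<in> nearest E M x"
  using theI'[OF rd_unique[of x]] by (simp add: rd_def)

lemma rd_fl [simp]: "rd x \<in> F"
  using rd_nearest by (simp add: nearest_def)

lemma rd_le_dist: "g \<in> F \<Longrightarrow> \<bar>rd x - x\<bar> \<le> \<bar>g - x\<bar>"
  using rd_nearest by (simp add: nearest_def)

lemma rd_id [simp]: "x \<in> F \<Longrightarrow> rd x = x"
  using rd_le_dist[of x x] by simp

lemma rd_eqI: "(\<And>g. g \<in> F \<Longrightarrow> g \<noteq> f \<Longrightarrow> \<bar>f - x\<bar> < \<bar>g - x\<bar>) \<Longrightarrow> f \<in> F \<Longrightarrow> rd x = f"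
  by (metis linorder_not_less rd_fl rd_le_dist)

text \<open>If \<open>rd y < rd x\<close>, the midpoint of these two floats is at most
  \<open>x\<close> and at least \<open>y\<close>, contradicting \<open>x < y\<close>. Ties matter
  only for \<open>x = y\<close>.\<close>

lemma rd_mono: "x \<le> y \<Longrightarrow> rd x \<le> rd y"
proof (cases "x = y")
  case False
  assume "x \<le> y"
  then show ?thesis
    using False rd_le_dist[of "rd y" x] rd_le_dist[of "rd x" y] by simp
qed simp

lemma rd_le: "x \<le> y \<Longrightarrow> y \<in> F \<Longrightarrow> rd x \<le> y"
  using rd_mono[of x y] by simp

lemma rd_ge: "y \<le> x \<Longrightarrow> y \<in> F \<Longrightarrow> y \<le> rd x"
  using rd_mono[of y x] by simp

lemma nearest_uminus: "f \<in> nearest E M (- x) \<longleftrightarrow> - f \<in> nearest E M x"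
proof -
  have "f \<in> nearest E M (- x)" if "- f \<in> nearest E M x" for f x
  proof -
    have "\<bar>f + x\<bar> \<le> \<bar>g + x\<bar>" if "g \<in> F" for g
    proof -
      have "\<bar>- f - x\<bar> \<le> \<bar>- g - x\<bar>" using that \<open>- f \<in> _\<close> by (simp add: nearest_def)
      then show ?thesis by linarith
    qed
    then show ?thesis using that by (auto simp: nearest_def)
  qed
  from this[of f x] this[of "- f" "- x"] show ?thesis by auto
qed

lemma rd_uminus: "rd (- x) = - rd x"
proof -
  have *: "rd x \<in> nearest E M x \<and> (\<forall>g \<in> nearest E M x. g \<noteq> rd x \<longrightarrow> fl_even E M (rd x))"
    using theI'[OF rd_unique[of x]] by (simp add: rd_def)
  show ?thesis
    unfolding rd_def[of "- x"]
  proof (rule the1_equality[OF rd_unique], intro conjI ballI impI)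
    show "- rd x \<in> nearest E M (- x)" using * by (simp add: nearest_uminus)
    fix g assume "g \<in> nearest E M (- x)" "g \<noteq> - rd x"
    then show "fl_even E M (- rd x)" using * by (force simp: nearest_uminus)
  qed
qed

section \<open>The least positive float and the contraction towards it\<close>

definition w :: real where "w = 2 powi qmin"

lemma w_pos [simp]: "0 < w" "0 \<le> w" "\<not> w \<le> 0"
  by (simp_all add: w_def)

lemma small_multiple_fl: "\<bar>J\<bar> < 2 ^ 4 \<Longrightarrow> of_int J * w \<in> F"
  unfolding w_def using qmin_le by (intro small_int_fl) auto

lemma w_fl [simp]: "w \<in> F"
  using small_multiple_fl[of 1] by simp

lemma fl_multiple_w:
  assumes "x \<in> F" obtains J where "x = of_int J * w"
  using fl_multiple[OF assms, of qmin] by (auto simp: w_def)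

lemma fl_gap:
  assumes "x \<in> F" "y \<in> F" "x < y" shows "x + w \<le> y"
proof -
  obtain J K where x: "x = of_int J * w" and y: "y = of_int K * w"
    using fl_multiple_w assms by metis
  have "J + 1 \<le> K" using assms(3) x y by (simp add: mult_less_cancel_right)
  then have "of_int (J + 1) * w \<le> of_int K * w" by (intro mult_right_mono) (simp_all only: of_int_le_iff w_pos)
  then show ?thesis using x y by (simp add: algebra_simps)
qed

text \<open>All floats are multiples of \<open>w\<close> and the small multiples are all floats, so
  near \<open>0\<close> rounding acts in units of \<open>w\<close> as rounding to the nearest
  integer.\<close>

lemma rd_multiple_w:
  assumes "\<bar>t - of_int J\<bar> < 1 / 2" "\<bar>J\<bar> < 2 ^ 4"
  shows "rd (t * w) = of_int J * w"
proof (rule rd_eqI)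
  fix g assume "g \<in> F" "g \<noteq> of_int J * w"
  then obtain K where g: "g = of_int K * w" "K \<noteq> J" using fl_multiple_w by metis
  then have "1 \<le> \<bar>K - J\<bar>" by linarith
  then have "1 \<le> \<bar>of_int K - of_int J :: real\<bar>" by linarith
  then have "\<bar>of_int J - t\<bar> < \<bar>of_int K - t\<bar>" using assms by linarith
  then have "\<bar>of_int J - t\<bar> * w < \<bar>of_int K - t\<bar> * w" by simp
  moreover have "\<bar>a - t\<bar> * w = \<bar>a * w - t * w\<bar>" for a
    by (metis abs_mult abs_of_pos left_diff_distrib w_pos)
  ultimately show "\<bar>of_int J * w - t * w\<bar> < \<bar>g - t * w\<bar>" by (simp add: g)
qed (use assms small_multiple_fl in auto)

text \<open>The bound \<open>y / 4\<close> is the reflection of \<open>y\<close> in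
  \<open>5 / 8 * y\<close>: any float strictly between the two is closer to \<open>5 / 8 * y\<close>
  than \<open>y\<close> is, so \<open>shrink\<close> cannot stall above \<open>w\<close>.\<close>

lemma fl_pos_between:
  assumes "y \<in> F" "w < y"
  obtains g where "g \<in> F" "y / 4 < g" "g < y"
proof -
  obtain J q where J: "y = of_int J * 2 powi q" "\<bar>J\<bar> < 2 ^ (M + 1)" "qmin \<le> q" "q \<le> qmax"
    "2 ^ M \<le> \<bar>J\<bar> \<or> q = qmin" using fl_canonical[OF assms(1)] by metis
  have "0 < y" using assms(2) w_pos by linarith
  then have "0 < J" using J(1) by (simp add: zero_less_mult_iff)
  \<comment> \<open>A canonical significand \<open>1\<close> is subnormal, which would make
    \<open>y\<close> equal to \<open>w\<close>.\<close>
  have "J \<noteq> 1"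
  proof
    assume "J = 1"
    moreover have "(2::int) ^ 3 \<le> 2 ^ M" using M_ge by (intro power_increasing) auto
    ultimately have "q = qmin" using J(5) by simp
    then show False using J(1) \<open>J = 1\<close> assms(2) by (simp add: w_def)
  qed
  then have "2 \<le> J" using \<open>0 < J\<close> by simp
  define g :: real where "g = of_int (J - 1) * 2 powi q"
  have "g \<in> F" unfolding g_def using J \<open>0 < J\<close> by (intro fl_I) auto
  moreover have "g < y" by (simp add: g_def J(1))
  moreover have "of_int J < (4 * of_int (J - 1) :: real)" using \<open>2 \<le> J\<close> by simp
  then have "of_int J * 2 powi q < (4 * of_int (J - 1) :: real) * 2 powi q"
    by (intro mult_strict_right_mono) auto
  then have "y / 4 < g" by (simp add: g_def J(1))
  ultimately show ?thesis using that by blast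
qed

text \<open>Multiplication by \<open>5/8\<close> contracts towards \<open>{- w, 0, w}\<close> but, since \<open>5/8 > 1/2\<close>, never
  reaches \<open>0\<close> from a nonzero float.\<close>
definition shrink :: "real \<Rightarrow> real" where "shrink y = rd (5 / 8 * y)"

lemma shrink_fl [simp]: "shrink y \<in> F"
  by (simp add: shrink_def)

lemma shrink_w: "shrink w = w"
  using rd_multiple_w[of "5/8" 1] by (simp add: shrink_def)

lemma shrink_ge: "w \<le> y \<Longrightarrow> w \<le> shrink y"
  using shrink_w rd_mono[of "5 / 8 * w" "5 / 8 * y"] by (simp add: shrink_def)

lemma shrink_less:
  assumes "y \<in> F" "w < y" shows "shrink y < y"
proof -
  obtain g where "g \<in> F" "y / 4 < g" "g < y" using fl_pos_between assms by blast
  moreover have "\<bar>shrink y - 5 / 8 * y\<bar> \<le> \<bar>g - 5 / 8 * y\<bar>"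
    unfolding shrink_def using calculation by (intro rd_le_dist)
  ultimately show ?thesis by linarith
qed

text \<open>The number of floats strictly between \<open>0\<close> and \<open>y\<close> drops with
  every step until the fixed point \<open>w\<close> is reached.\<close>

lemma shrink_iter_pos:
  assumes "y \<in> F" "0 < y" "card {f \<in> F. 0 < f \<and> f < y} \<le> N"
  shows "(shrink ^^ N) y = w"
  using assms
proof (induction N arbitrary: y)
  case 0
  have "\<not> w < y"
  proof
    assume "w < y"
    then have "w \<in> {f \<in> F. 0 < f \<and> f < y}" by simp
    then show False using 0 finite_fl by auto
  qed
  moreover have "w \<le> y" using fl_gap[of 0 y] 0 by simp
  ultimately show ?case by simp
next
  case (Suc N)
  have "w \<le> y" using fl_gap[of 0 y] Suc.prems by simp
  have le: "0 < shrink y" using shrink_ge[OF \<open>w \<le> y\<close>] w_pos by linarith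
  have "card {f \<in> F. 0 < f \<and> f < shrink y} \<le> N"
  proof (cases "w < y")
    case True
    have "shrink y < y" using shrink_less Suc.prems True by blast
    then have "{f \<in> F. 0 < f \<and> f < shrink y} \<subset> {f \<in> F. 0 < f \<and> f < y}"
      using le shrink_fl by force
    then have "card {f \<in> F. 0 < f \<and> f < shrink y} < card {f \<in> F. 0 < f \<and> f < y}"
      using finite_fl by (intro psubset_card_mono) auto
    then show ?thesis using Suc.prems(3) by simp
  next
    case False
    then have "shrink y = w" using \<open>w \<le> y\<close> shrink_w by simp
    then have "{f \<in> F. 0 < f \<and> f < shrink y} = {}" using fl_gap[of 0] by force
    then show ?thesis by (simp only: card.empty le0)
  qed
  then show ?case using Suc.IH[OF shrink_fl le] by (simp add: funpow_swap1)
qed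

lemma shrink_iter:
  obtains N where "\<And>y. y \<in> F \<Longrightarrow> (shrink ^^ N) y = sgn y * w"
proof
  fix y assume y: "y \<in> F"
  \<comment> \<open>One iteration count must serve all inputs, since a straight-line program cannot
    branch.\<close>
  let ?N = "card F"
  have le: "card {f \<in> F. 0 < f \<and> f < z} \<le> ?N" for z
    using finite_fl by (intro card_mono) auto
  have neg: "(shrink ^^ n) (- z) = - (shrink ^^ n) z" for n z
    by (induction n) (auto simp: shrink_def rd_uminus)
  have zero: "(shrink ^^ n) 0 = 0" for n
    by (induction n) (auto simp: shrink_def)
  consider "y = 0" | "0 < y" | "0 < - y" by linarith
  then show "(shrink ^^ ?N) y = sgn y * w"
  proof cases
    case 3
    then have "(shrink ^^ ?N) (- y) = w" using shrink_iter_pos[of "- y" ?N] le y by simp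
    then show ?thesis using 3 neg[of ?N y] by simp
  qed (use zero shrink_iter_pos[of y ?N] le y in auto)
qed

text \<open>The overflow threshold, half a spacing beyond \<open>Om\<close>; \<open>rnd_eq\<close>
  matches it with the form used in \<open>rnd\<close>.\<close>

definition ovf :: real where "ovf = Om + 2 powi (qmax - 1)"

definition rdx :: "real \<Rightarrow> ereal" where
  "rdx x = (if \<bar>x\<bar> \<ge> ovf then (if x > 0 then \<infinity> else - \<infinity>) else ereal (rd x))"

lemma ovf_pos: "0 < ovf"
  using fl_le_Om[of 0] by (simp add: ovf_def add_nonneg_pos)

lemma rdx_eq: "\<bar>x\<bar> < ovf \<Longrightarrow> rdx x = ereal (rd x)"
  by (simp add: rdx_def)

lemma rnd_eq: "rnd E M x = Val (rdx x)"
proof -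
  have pw: "2 powr real_of_int k = 2 powi k" for k by (simp add: powr_real_of_int')
  have "Omega E M = 2 powi emax E * (2 - 2 powi (- int M))"
    unfolding Omega_def pw[symmetric] by simp
  also have "\<dots> = Om"
    by (simp add: Om_def qmax_def power_int_diff power_int_minus field_simps)
  finally have 1: "Omega E M = Om" .
  have "eps M = 2 powi (- int M - 1)" unfolding eps_def pw[symmetric] by simp
  then have 2: "2 powr real_of_int (emax E) * eps M = 2 powi (qmax - 1)"
    unfolding pw by (simp add: qmax_def power_int_diff power_int_add power_int_minus field_simps)
  show ?thesis unfolding rnd_def 1 2 rdx_def ovf_def rd_def by simp
qed

lemma rdx_mono: "x \<le> y \<Longrightarrow> rdx x \<le> rdx y"
  using rd_mono[of x y] ovf_pos by (auto simp: rdx_def)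

lemma less_ovf: "\<bar>x\<bar> \<le> Om \<Longrightarrow> \<bar>x\<bar> < ovf"
  using zero_less_power_int[of "2::real" "qmax - 1"] unfolding ovf_def by linarith

end

section \<open>Straight-line programs and expressions\<close>

datatype expr = Inp nat | Const real | Op opr expr expr

fun expr_ok :: "nat \<Rightarrow> nat \<Rightarrow> nat \<Rightarrow> expr \<Rightarrow> bool" where
  "expr_ok E M n (Inp i) = (i < n)"
| "expr_ok E M n (Const r) = (r \<in> fl E M)"
| "expr_ok E M n (Op f a b) = (expr_ok E M n a \<and> expr_ok E M n b)"

fun expr_val :: "(opr \<Rightarrow> 'v \<Rightarrow> 'v \<Rightarrow> 'v) \<Rightarrow> (real \<Rightarrow> 'v) \<Rightarrow> 'v list \<Rightarrow> expr \<Rightarrow> 'v" where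
  "expr_val opf cf xs (Inp i) = xs ! i"
| "expr_val opf cf xs (Const r) = cf r"
| "expr_val opf cf xs (Op f a b) = opf f (expr_val opf cf xs a) (expr_val opf cf xs b)"

definition exec :: "(opr \<Rightarrow> 'v \<Rightarrow> 'v \<Rightarrow> 'v) \<Rightarrow> (real \<Rightarrow> 'v) \<Rightarrow> 'v list \<Rightarrow> instr list \<Rightarrow> 'v list" where
  "exec opf cf xs is = foldl (\<lambda>vs (f, u, u'). vs @ [opf f (argv cf xs vs u) (argv cf xs vs u')]) [] is"

lemma run_exec: "run opf cf p xs = map (argv cf xs (exec opf cf xs (fst p))) (snd p)"
  by (simp add: run_def exec_def)

lemma exec_Nil [simp]: "exec opf cf xs [] = []"
  by (simp add: exec_def)

lemma exec_snoc [simp]: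
  "exec opf cf xs (is @ [(f, u, u')]) = exec opf cf xs is @
     [opf f (argv cf xs (exec opf cf xs is) u) (argv cf xs (exec opf cf xs is) u')]"
  by (simp add: exec_def)

lemma length_exec [simp]: "length (exec opf cf xs is) = length is"
  by (induction "is" rule: rev_induct) auto

definition instrs_ok :: "nat \<Rightarrow> nat \<Rightarrow> nat \<Rightarrow> instr list \<Rightarrow> bool" where
  "instrs_ok E M n is \<longleftrightarrow>
    (\<forall>k < length is. case is ! k of (f, u, u') \<Rightarrow> arg_ok E M n k u \<and> arg_ok E M n k u')"

lemma instrs_ok_Nil [simp]: "instrs_ok E M n []"
  by (simp add: instrs_ok_def)

lemma instrs_ok_snoc [simp]:
  "instrs_ok E M n (is @ [(f, u, u')]) \<longleftrightarrow>
     instrs_ok E M n is \<and> arg_ok E M n (length is) u \<and> arg_ok E M n (length is) u'"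
  by (auto simp: instrs_ok_def nth_append less_Suc_eq)

lemma exec_append: "\<exists>ws. exec opf cf xs (is @ js) = exec opf cf xs is @ ws"
proof (induction js rule: rev_induct)
  case (snoc j js)
  then show ?case by (cases j) (auto simp flip: append_assoc, simp)
qed simp

lemma argv_exec_append:
  "arg_ok E M n (length is) u \<Longrightarrow>
     argv cf xs (exec opf cf xs (is @ js)) u = argv cf xs (exec opf cf xs is) u"
  using exec_append[of opf cf xs "is" js] by (cases u) (auto simp: nth_append)

lemma arg_ok_mono: "arg_ok E M n k u \<Longrightarrow> k \<le> k' \<Longrightarrow> arg_ok E M n k' u"
  by (cases u) auto

text \<open>Generalizing over the instructions \<open>is\<close> already emitted lets the code of
  the second operand follow that of the first: appended code never changes earlier
  variables.\<close>

lemma compile_expr: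
  assumes "expr_ok E M n e" "instrs_ok E M n is"
  shows "\<exists>js u. instrs_ok E M n (is @ js) \<and> arg_ok E M n (length (is @ js)) u \<and>
    (\<forall>xs. argv cf xs (exec opf cf xs (is @ js)) u = expr_val opf cf xs e)"
  using assms
proof (induction e arbitrary: "is")
  case (Inp i)
  then show ?case by (intro exI[of _ "[]"] exI[of _ "In i"]) auto
next
  case (Const r)
  then show ?case by (intro exI[of _ "[]"] exI[of _ "C r"]) auto
next
  case (Op f a b)
  obtain js u where 1: "instrs_ok E M n (is @ js)" "arg_ok E M n (length (is @ js)) u"
    "\<And>xs. argv cf xs (exec opf cf xs (is @ js)) u = expr_val opf cf xs a"
    using Op.IH(1)[of "is"] Op.prems by auto
  obtain ks u' where 2: "instrs_ok E M n ((is @ js) @ ks)" "arg_ok E M n (length ((is @ js) @ ks)) u'"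
    "\<And>xs. argv cf xs (exec opf cf xs ((is @ js) @ ks)) u' = expr_val opf cf xs b"
    using Op.IH(2)[OF _ 1(1)] Op.prems by auto
  let ?js = "js @ ks @ [(f, u, u')]"
  have eq: "is @ ?js = ((is @ js) @ ks) @ [(f, u, u')]" by simp
  have "arg_ok E M n (length ((is @ js) @ ks)) u" by (rule arg_ok_mono[OF 1(2)]) simp
  then have "instrs_ok E M n (is @ ?js)" unfolding eq instrs_ok_snoc using 2 by blast
  moreover have "argv cf xs (exec opf cf xs (is @ ?js)) (V (length ((is @ js) @ ks)))
      = expr_val opf cf xs (Op f a b)" for xs
    unfolding eq exec_snoc argv_exec_append[OF 1(2)] 1(3) 2(3) by (simp add: nth_append)
  ultimately show ?case
    by (intro exI[of _ ?js] exI[of _ "V (length ((is @ js) @ ks))"]) auto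
qed

lemma compile_exprs:
  assumes "\<forall>e \<in> set es. expr_ok E M n e"
  shows "\<exists>p. wf_prog E M n (length es) p \<and> (\<forall>xs. run opf cf p xs = map (expr_val opf cf xs) es)"
proof -
  have "\<exists>is us. instrs_ok E M n is \<and> length us = length es \<and> (\<forall>u \<in> set us. arg_ok E M n (length is) u) \<and>
    (\<forall>xs. map (argv cf xs (exec opf cf xs is)) us = map (expr_val opf cf xs) es)"
    using assms
  proof (induction es rule: rev_induct)
    case Nil
    then show ?case by (intro exI[of _ "[]"]) auto
  next
    case (snoc e es)
    then obtain "is" us where 1: "instrs_ok E M n is" "length us = length es"
      "\<forall>u \<in> set us. arg_ok E M n (length is) u"
      "\<And>xs. map (argv cf xs (exec opf cf xs is)) us = map (expr_val opf cf xs) es" by auto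
    obtain js u where 2: "instrs_ok E M n (is @ js)" "arg_ok E M n (length (is @ js)) u"
      "\<And>xs. argv cf xs (exec opf cf xs (is @ js)) u = expr_val opf cf xs e"
      using compile_expr[of E M n e "is" cf opf] snoc.prems 1(1) by auto
    have "map (argv cf xs (exec opf cf xs (is @ js))) us = map (argv cf xs (exec opf cf xs is)) us" for xs
      using 1(3) argv_exec_append by (intro map_cong refl) blast
    moreover have "\<forall>u \<in> set us. arg_ok E M n (length (is @ js)) u"
      using 1(3) arg_ok_mono by fastforce
    ultimately show ?case using 1 2 by (intro exI[of _ "is @ js"] exI[of _ "us @ [u]"]) auto
  qed
  then obtain "is" us where "instrs_ok E M n is" "length us = length es"
    "\<forall>u \<in> set us. arg_ok E M n (length is) u"
    "\<And>xs. map (argv cf xs (exec opf cf xs is)) us = map (expr_val opf cf xs) es" by blast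
  then show ?thesis
    by (intro exI[of _ "(is, us)"]) (auto simp: wf_prog_def run_exec instrs_ok_def)
qed

section \<open>Concrete evaluation as interval evaluation on points\<close>

fun sing :: "fval \<Rightarrow> itv" where
  "sing (Val r) = Itv r r"
| "sing NaN = Top"

lemma sing_inject: "sing v = Itv r r \<Longrightarrow> v = Val r"
  by (cases v) auto

lemma iop_sing: "iop (fop E M f) (sing a) (sing b) = sing (fop E M f a b)"
proof (cases "a = NaN \<or> b = NaN")
  case True
  moreover have "fop E M f NaN v = NaN" "fop E M f v NaN = NaN" for v
    by (cases f; cases v; simp add: fop_def)+
  ultimately show ?thesis by (cases a; cases b) auto
next
  case False
  then obtain r s where [simp]: "a = Val r" "b = Val s" by (metis fval.exhaust)
  show ?thesis by (cases "fop E M f (Val r) (Val s)") auto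
qed

text \<open>\<open>NaN\<close> is absorbing for the float operations just as \<open>Top\<close> is
  for the interval ones. The concrete semantics can thus be read off from the interval semantics on
  point boxes.\<close>

lemma Qa_sing:
  assumes "wf_prog E M n m p" "length xs = n"
  shows "Qa E M p (map (\<lambda>x. Itv (ereal x) (ereal x)) xs) = map sing (Qc E M p xs)"
proof -
  let ?a = "exec (\<lambda>f. iop (fop E M f)) (\<lambda>c. Itv (ereal c) (ereal c)) (map (\<lambda>x. Itv (ereal x) (ereal x)) xs)"
  let ?c = "exec (fop E M) (\<lambda>c. Val (ereal c)) (map (\<lambda>x. Val (ereal x)) xs)"
  have arg: "argv (\<lambda>c. Itv (ereal c) (ereal c)) (map (\<lambda>x. Itv (ereal x) (ereal x)) xs) (map sing vs) u
      = sing (argv (\<lambda>c. Val (ereal c)) (map (\<lambda>x. Val (ereal x)) xs) vs u)"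
    if "arg_ok E M n (length vs) u" for u vs
    using that assms(2) by (cases u) auto
  have exec: "?a is = map sing (?c is)" if "instrs_ok E M n is" for "is"
    using that
  proof (induction "is" rule: rev_induct)
    case (snoc i "is")
    then show ?case by (cases i) (auto simp: arg iop_sing)
  qed simp
  have "instrs_ok E M n (fst p)" "\<forall>u \<in> set (snd p). arg_ok E M n (length (fst p)) u"
    using assms by (auto simp: wf_prog_def instrs_ok_def)
  then show ?thesis by (simp add: Qa_def Qc_def run_exec exec arg)
qed

section \<open>Interval-exact expressions\<close>

text \<open>The value \<open>0\<close> at \<open>Top\<close> and at infinite ends is a dummy: these
  functions serve boxes with finite ends.\<close>

fun lo :: "itv \<Rightarrow> real" where "lo (Itv a b) = real_of_ereal a" | "lo Top = 0"
fun hi :: "itv \<Rightarrow> real" where "hi (Itv a b) = real_of_ereal b" | "hi Top = 0"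

text \<open>It suffices to bound the four corner values and to name corners where the bounds are
  attained.\<close>

lemma iop_hull:
  assumes "\<And>x y. x \<in> {a, b} \<Longrightarrow> y \<in> {c, d} \<Longrightarrow> \<exists>r. g (Val x) (Val y) = Val r \<and> l \<le> r \<and> r \<le> u"
    and "Val l \<in> {g (Val a) (Val c), g (Val a) (Val d), g (Val b) (Val c), g (Val b) (Val d)}"
    and "Val u \<in> {g (Val a) (Val c), g (Val a) (Val d), g (Val b) (Val c), g (Val b) (Val d)}"
  shows "iop g (Itv a b) (Itv c d) = Itv l u"
proof -
  let ?S = "{g (Val a) (Val c), g (Val a) (Val d), g (Val b) (Val c), g (Val b) (Val d)}"
  have S: "\<exists>r. s = Val r \<and> l \<le> r \<and> r \<le> u" if "s \<in> ?S" for s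
    using that assms(1) by blast
  have "NaN \<notin> ?S" using S by blast
  have fin: "finite {r. Val r \<in> ?S}"
    using finite_vimageI[of ?S Val] by (simp add: vimage_def inj_def)
  have "Min {r. Val r \<in> ?S} = l" using fin S assms(2) by (intro Min_eqI) auto
  moreover have "Max {r. Val r \<in> ?S} = u" using fin S assms(3) by (intro Max_eqI) auto
  ultimately show ?thesis using \<open>NaN \<notin> ?S\<close> by (simp only: iop.simps Let_def if_False)
qed

context float_format begin

lemma iop_fadd:
  assumes "l \<le> h" "l' \<le> h'"
  shows "iop (fop E M Add) (Itv (ereal l) (ereal h)) (Itv (ereal l') (ereal h')) =
    Itv (rdx (l + l')) (rdx (h + h'))"
  using assms by (intro iop_hull) (auto simp: fop_def rnd_eq intro!: rdx_mono)

lemma iop_fmul_pos: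
  assumes "l \<le> h" "0 \<le> c"
  shows "iop (fop E M Mul) (Itv (ereal c) (ereal c)) (Itv (ereal l) (ereal h)) =
    Itv (rdx (c * l)) (rdx (c * h))"
  using assms by (intro iop_hull) (auto simp: fop_def rnd_eq intro!: rdx_mono mult_left_mono)

lemma iop_fmul_neg:
  assumes "l \<le> h" "c \<le> 0"
  shows "iop (fop E M Mul) (Itv (ereal c) (ereal c)) (Itv (ereal l) (ereal h)) =
    Itv (rdx (c * h)) (rdx (c * l))"
  using assms by (intro iop_hull) (auto simp: fop_def rnd_eq intro!: rdx_mono mult_left_mono_neg)

definition fboxes :: "nat \<Rightarrow> itv list set" where
  "fboxes n = {B. length B = n \<and> set B \<subseteq> {Itv (ereal l) (ereal u) | l u. l \<in> F \<and> u \<in> F \<and> l \<le> u}}"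

lemma fboxes_nth:
  assumes "B \<in> fboxes n" "i < n"
  shows "B ! i = Itv (ereal (lo (B ! i))) (ereal (hi (B ! i)))" "lo (B ! i) \<in> F" "hi (B ! i) \<in> F"
    "lo (B ! i) \<le> hi (B ! i)"
proof -
  have "B ! i \<in> {Itv (ereal l) (ereal u) | l u. l \<in> F \<and> u \<in> F \<and> l \<le> u}"
    using assms nth_mem[of i B] unfolding fboxes_def by blast
  then show "B ! i = Itv (ereal (lo (B ! i))) (ereal (hi (B ! i)))" "lo (B ! i) \<in> F" "hi (B ! i) \<in> F"
    "lo (B ! i) \<le> hi (B ! i)" by auto
qed

lemma finite_fboxes: "finite (fboxes n)"
proof -
  have "{Itv (ereal l) (ereal u) | l u. l \<in> F \<and> u \<in> F \<and> l \<le> u}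
      \<subseteq> (\<lambda>(l, u). Itv (ereal l) (ereal u)) ` (F \<times> F)" by auto
  then have "finite {Itv (ereal l) (ereal u) | l u. l \<in> F \<and> u \<in> F \<and> l \<le> u}"
    by (rule finite_subset) (simp add: finite_fl)
  from finite_lists_length_eq[OF this, of n] show ?thesis
    by (simp add: fboxes_def conj_commute)
qed

abbreviation itv_val :: "itv list \<Rightarrow> expr \<Rightarrow> itv" where
  "itv_val \<equiv> expr_val (\<lambda>f. iop (fop E M f)) (\<lambda>c. Itv (ereal c) (ereal c))"

text \<open>The invariant of the construction: one expression computes both end functions. Finite
  ends keep sums and products free of \<open>NaN\<close>, and their order makes the monotone
  endpoint rules applicable.\<close>

definition realizable :: "nat \<Rightarrow> (itv list \<Rightarrow> real) \<Rightarrow> (itv list \<Rightarrow> real) \<Rightarrow> bool" where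
  "realizable n l h \<longleftrightarrow> (\<exists>e. expr_ok E M n e \<and> (\<forall>B \<in> fboxes n.
     itv_val B e = Itv (ereal (l B)) (ereal (h B)) \<and> l B \<in> F \<and> h B \<in> F \<and> l B \<le> h B))"

lemma realizable_fl:
  "realizable n l h \<Longrightarrow> B \<in> fboxes n \<Longrightarrow> l B \<in> F \<and> h B \<in> F \<and> l B \<le> h B"
  unfolding realizable_def by blast

lemma realizableE:
  assumes "realizable n l h"
  obtains e where "expr_ok E M n e"
    "\<forall>B \<in> fboxes n. itv_val B e = Itv (ereal (l B)) (ereal (h B)) \<and> l B \<le> h B"
proof -
  from assms obtain e where "expr_ok E M n e \<and> (\<forall>B \<in> fboxes n.
     itv_val B e = Itv (ereal (l B)) (ereal (h B)) \<and> l B \<in> F \<and> h B \<in> F \<and> l B \<le> h B)"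
    unfolding realizable_def by (rule exE)
  then show ?thesis by (intro that[of e]) simp_all
qed

lemma realizable_cong:
  "realizable n l h \<Longrightarrow> (\<And>B. B \<in> fboxes n \<Longrightarrow> l B = l' B \<and> h B = h' B) \<Longrightarrow> realizable n l' h'"
  unfolding realizable_def by fastforce

lemma realizable_const: "c \<in> F \<Longrightarrow> realizable n (\<lambda>_. c) (\<lambda>_. c)"
  unfolding realizable_def by (intro exI[of _ "Const c"]) auto

lemma realizable_input: "i < n \<Longrightarrow> realizable n (\<lambda>B. lo (B ! i)) (\<lambda>B. hi (B ! i))"
  unfolding realizable_def using fboxes_nth by (intro exI[of _ "Inp i"]) auto

lemma realizable_add:
  assumes "realizable n l h" "realizable n l' h'"
    and "\<And>B. B \<in> fboxes n \<Longrightarrow> \<bar>l B + l' B\<bar> < ovf \<and> \<bar>h B + h' B\<bar> < ovf"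
  shows "realizable n (\<lambda>B. rd (l B + l' B)) (\<lambda>B. rd (h B + h' B))"
proof -
  obtain e where e: "expr_ok E M n e"
    "\<forall>B \<in> fboxes n. itv_val B e = Itv (ereal (l B)) (ereal (h B)) \<and> l B \<le> h B" using assms(1) by (rule realizableE)
  obtain e' where e': "expr_ok E M n e'"
    "\<forall>B \<in> fboxes n. itv_val B e' = Itv (ereal (l' B)) (ereal (h' B)) \<and> l' B \<le> h' B" using assms(2) by (rule realizableE)
  have "itv_val B (Op Add e e') = Itv (ereal (rd (l B + l' B))) (ereal (rd (h B + h' B))) \<and>
      rd (l B + l' B) \<le> rd (h B + h' B)" if "B \<in> fboxes n" for B
    using e(2)[rule_format, OF that] e'(2)[rule_format, OF that] assms(3)[OF that]
    by (auto simp: iop_fadd rdx_eq simp del: iop.simps intro!: rd_mono add_mono)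
  then show ?thesis unfolding realizable_def using e(1) e'(1)
    by (intro exI[of _ "Op Add e e'"]) auto
qed

lemma realizable_scale:
  assumes "realizable n l h" "c \<in> F" "0 \<le> c"
    and "\<And>B. B \<in> fboxes n \<Longrightarrow> \<bar>c * l B\<bar> \<le> Om \<and> \<bar>c * h B\<bar> \<le> Om"
  shows "realizable n (\<lambda>B. rd (c * l B)) (\<lambda>B. rd (c * h B))"
proof -
  obtain e where e: "expr_ok E M n e"
    "\<forall>B \<in> fboxes n. itv_val B e = Itv (ereal (l B)) (ereal (h B)) \<and> l B \<le> h B" using assms(1) by (rule realizableE)
  have ovf: "\<bar>c * l B\<bar> < ovf \<and> \<bar>c * h B\<bar> < ovf" if "B \<in> fboxes n" for B
    using less_ovf assms(4)[OF that] by blast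
  have "itv_val B (Op Mul (Const c) e) = Itv (ereal (rd (c * l B))) (ereal (rd (c * h B))) \<and>
      rd (c * l B) \<le> rd (c * h B)" if "B \<in> fboxes n" for B
    using ovf[OF that] e(2)[rule_format, OF that] assms(3)
    by (auto simp: iop_fmul_pos rdx_eq simp del: iop.simps intro!: rd_mono mult_left_mono)
  then show ?thesis unfolding realizable_def using assms(2) e(1)
    by (intro exI[of _ "Op Mul (Const c) e"]) auto
qed

lemma small_fl:
  "5 / 8 \<in> F" "3 / 8 \<in> F" "1 / 2 \<in> F" "1 \<in> F" "2 \<in> F"
  using small_int_fl[of 5 "-3"] small_int_fl[of 3 "-3"] small_int_fl[of 1 "-1"]
    small_int_fl[of 2 "-1"] small_int_fl[of 4 "-1"] qmax_ge qmin_le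
  by (simp_all add: power_int_minus)

lemma realizable_uminus:
  assumes "realizable n l h"
  shows "realizable n (\<lambda>B. - h B) (\<lambda>B. - l B)"
proof -
  obtain e where e: "expr_ok E M n e"
    "\<forall>B \<in> fboxes n. itv_val B e = Itv (ereal (l B)) (ereal (h B)) \<and> l B \<le> h B" using assms(1) by (rule realizableE)
  note fl = realizable_fl[OF assms]
  have ovf: "\<bar>l B\<bar> < ovf \<and> \<bar>h B\<bar> < ovf" if "B \<in> fboxes n" for B
    using less_ovf fl[OF that] fl_le_Om by blast
  have "itv_val B (Op Mul (Const (- 1)) e) = Itv (ereal (- h B)) (ereal (- l B)) \<and>
      - h B \<in> F \<and> - l B \<in> F \<and> - h B \<le> - l B" if "B \<in> fboxes n" for B
    using ovf[OF that] e(2)[rule_format, OF that] fl[OF that]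
    by (simp add: iop_fmul_neg rdx_eq rd_uminus del: iop.simps)
  then show ?thesis unfolding realizable_def using small_fl e(1)
    by (intro exI[of _ "Op Mul (Const (- 1)) e"]) auto
qed

text \<open>Truth is encoded as \<open>w\<close> because iterated shrinking produces it from any
  positive float. In the final use \<open>p\<close> means "everywhere in the box" and
  \<open>q\<close> "somewhere in the box".\<close>

definition indicates :: "nat \<Rightarrow> (itv list \<Rightarrow> bool) \<Rightarrow> (itv list \<Rightarrow> bool) \<Rightarrow> bool" where
  "indicates n p q \<longleftrightarrow> realizable n (\<lambda>B. if p B then w else 0) (\<lambda>B. if q B then w else 0)"

lemma indicates_cong:
  "indicates n p q \<Longrightarrow> (\<And>B. B \<in> fboxes n \<Longrightarrow> p B = p' B \<and> q B = q' B) \<Longrightarrow> indicates n p' q'"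
  unfolding indicates_def by (erule realizable_cong) simp

lemma two_w: "2 * w \<in> F"
  using small_multiple_fl[of 2] by simp

lemma add_scale_realizable:
  assumes "realizable n l h" "realizable n l' h'" "c \<in> F" "0 \<le> c" "c \<le> 1"
    and "\<And>B. B \<in> fboxes n \<Longrightarrow> \<bar>l B + l' B\<bar> \<le> 2 * w \<and> \<bar>h B + h' B\<bar> \<le> 2 * w"
  shows "realizable n (\<lambda>B. rd (c * rd (l B + l' B))) (\<lambda>B. rd (c * rd (h B + h' B)))"
proof (intro realizable_scale realizable_add)
  fix B assume B: "B \<in> fboxes n"
  have "2 * w \<le> Om" using fl_le_Om[OF two_w] by simp
  then show "\<bar>l B + l' B\<bar> < ovf \<and> \<bar>h B + h' B\<bar> < ovf" using assms(6)[OF B] less_ovf by force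
  have "\<bar>c * x\<bar> \<le> Om" if "x \<in> F" for x
    using fl_le_Om[OF that] assms(4,5) mult_left_le_one_le[of "\<bar>x\<bar>" c] by (simp add: abs_mult)
  then show "\<bar>c * rd (l B + l' B)\<bar> \<le> Om \<and> \<bar>c * rd (h B + h' B)\<bar> \<le> Om" by simp
qed (use assms in auto)

text \<open>In units of \<open>w\<close> the scaled sums are \<open>0\<close>, \<open>5/8\<close>
  and \<open>5/4\<close>, which round to \<open>0\<close>, \<open>1\<close> and
  \<open>1\<close>.\<close>

lemma rd_or: "rd (5 / 8 * rd ((if a then w else 0) + (if b then w else 0))) = (if a \<or> b then w else 0)"
  using rd_multiple_w[of "5/8" 1] rd_multiple_w[of "5/4" 1] two_w by (auto simp flip: mult_2)

text \<open>In units of \<open>w\<close> the scaled sums are \<open>0\<close>, \<open>3/8\<close>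
  and \<open>3/4\<close>, which round to \<open>0\<close>, \<open>0\<close> and
  \<open>1\<close>.\<close>

lemma rd_and: "rd (3 / 8 * rd ((if a then w else 0) + (if b then w else 0))) = (if a \<and> b then w else 0)"
  using rd_multiple_w[of "3/8" 0] rd_multiple_w[of "3/4" 1] two_w by (auto simp flip: mult_2)

lemma indicates_or:
  assumes "indicates n p q" "indicates n p' q'"
  shows "indicates n (\<lambda>B. p B \<or> p' B) (\<lambda>B. q B \<or> q' B)"
  unfolding indicates_def rd_or[symmetric]
  using small_fl by (intro add_scale_realizable assms[unfolded indicates_def]) auto

lemma indicates_and:
  assumes "indicates n p q" "indicates n p' q'"
  shows "indicates n (\<lambda>B. p B \<and> p' B) (\<lambda>B. q B \<and> q' B)"
  unfolding indicates_def rd_and[symmetric]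
  using small_fl by (intro add_scale_realizable assms[unfolded indicates_def]) auto

lemma indicates_True: "indicates n (\<lambda>_. True) (\<lambda>_. True)"
  by (simp add: indicates_def realizable_const)

lemma indicates_False: "indicates n (\<lambda>_. False) (\<lambda>_. False)"
  by (simp add: indicates_def realizable_const)

lemma indicates_all:
  fixes k :: nat
  shows "(\<And>i. i < k \<Longrightarrow> indicates n (p i) (q i)) \<Longrightarrow>
     indicates n (\<lambda>B. \<forall>i<k. p i B) (\<lambda>B. \<forall>i<k. q i B)"
proof (induction k)
  case (Suc k)
  then have "indicates n (\<lambda>B. (\<forall>i<k. p i B) \<and> p k B) (\<lambda>B. (\<forall>i<k. q i B) \<and> q k B)"
    by (intro indicates_and) auto
  then show ?case by (simp add: less_Suc_eq all_conj_distrib imp_disjL conj_commute)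
qed (simp add: indicates_True)

lemma indicates_ex:
  assumes "finite S" "\<And>s. s \<in> S \<Longrightarrow> indicates n (p s) (q s)"
  shows "indicates n (\<lambda>B. \<exists>s\<in>S. p s B) (\<lambda>B. \<exists>s\<in>S. q s B)"
  using assms by (induction S rule: finite_induct) (simp_all add: indicates_False indicates_or)

section \<open>Threshold comparisons without overflow\<close>

lemma half_fl:
  assumes "x \<in> F" "2 powi (emin E + 1) \<le> \<bar>x\<bar>" shows "x / 2 \<in> F"
proof -
  obtain J q where J: "x = of_int J * 2 powi q" "\<bar>J\<bar> < 2 ^ (M + 1)" "qmin \<le> q" "q \<le> qmax"
    using assms(1) unfolding fl_iff by blast
  have "q \<noteq> qmin"
  proof
    assume "q = qmin"
    have "2 powi (int M + (qmin + 1)) \<le> \<bar>x\<bar>" using assms(2) by (simp add: qmin_def algebra_simps)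
    also have "\<bar>x\<bar> = of_int \<bar>J\<bar> * 2 powi qmin" by (simp add: J(1) abs_mult \<open>q = qmin\<close>)
    also have "\<dots> < of_int (2 ^ (M + 1)) * 2 powi qmin"
      using J(2) by (intro mult_strict_right_mono) (simp_all only: of_int_less_iff zero_less_power_int zero_less_numeral)
    also have "\<dots> = 2 powi (int M + (qmin + 1))" by (simp add: power_int_add)
    finally show False by simp
  qed
  then have "of_int J * 2 powi (q - 1) \<in> F" using J by (intro fl_I) auto
  then show ?thesis by (simp add: J(1) power_int_diff)
qed

text \<open>Distinct floats differ by at least \<open>w\<close>, itself a float, so a negative
  difference cannot round up to \<open>0\<close>.\<close>

lemma rd_diff_nonneg_iff:
  assumes "x \<in> F" "c \<in> F" shows "0 \<le> rd (x - c) \<longleftrightarrow> c \<le> x"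
proof
  assume "0 \<le> rd (x - c)"
  show "c \<le> x"
  proof (rule ccontr)
    assume "\<not> c \<le> x"
    then have "x - c \<le> - w" using fl_gap[of x c] assms by simp
    then have "rd (x - c) \<le> - w" by (intro rd_le) auto
    then show False using \<open>0 \<le> rd (x - c)\<close> w_pos by linarith
  qed
qed (simp add: rd_ge)

text \<open>Halving is exact for \<open>c\<close> and for \<open>x\<close> of at least the threshold
  size. A smaller \<open>x\<close> has a rounded half of size at most \<open>2 powi emin E\<close>,
  less than \<open>\<bar>c\<bar> / 2\<close>, so only the sign of \<open>c\<close> matters.\<close>

lemma rd_half_ge_iff:
  assumes "x \<in> F" "c \<in> F" "2 powi (emin E + 1) < \<bar>c\<bar>"
  shows "c / 2 \<le> rd (1 / 2 * x) \<longleftrightarrow> c \<le> x"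
proof
  have c2: "c / 2 \<in> F" using half_fl assms by simp
  then show "c / 2 \<le> rd (1 / 2 * x)" if "c \<le> x" using that by (intro rd_ge) auto
  assume le: "c / 2 \<le> rd (1 / 2 * x)"
  show "c \<le> x"
  proof (cases "2 powi (emin E + 1) \<le> \<bar>x\<bar>")
    case True
    then show ?thesis using half_fl[OF assms(1)] le by simp
  next
    case False
    let ?t = "2 powi emin E :: real"
    have t: "?t \<in> F" using emin_eq emax_ge by (intro pow2_fl) (auto simp: qmin_def)
    have 2: "2 powi (emin E + 1) = 2 * ?t" by (simp add: power_int_add)
    have "- ?t \<le> rd (1 / 2 * x)" "rd (1 / 2 * x) \<le> ?t"
      using t False 2 by (auto intro!: rd_ge rd_le)
    then show ?thesis using assms(3) False le 2 by linarith
  qed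
qed

text \<open>\<open>x - c\<close> itself may overflow unless \<open>c\<close> is small; for large \<open>c\<close>, halving first still separates
  \<open>c\<close> from its predecessor.\<close>
lemma realizable_compare:
  assumes "realizable n l h" "c \<in> F"
  obtains f where "realizable n (\<lambda>B. f (l B)) (\<lambda>B. f (h B))" "\<And>x. x \<in> F \<Longrightarrow> 0 \<le> f x \<longleftrightarrow> c \<le> x"
proof (cases "\<bar>c\<bar> \<le> 2 powi (emin E + 1)")
  case True
  \<comment> \<open>The margin \<open>2 powi (qmax - 1)\<close> between \<open>Om\<close> and
    \<open>ovf\<close> absorbs so small a \<open>c\<close>.\<close>
  have "(2::real) powi (emin E + 1) < 2 powi (qmax - 1)"
    using qmax_ge emin_eq emax_ge by (intro power_int_strict_increasing) auto
  then have "\<bar>x + (- c)\<bar> < ovf" if "x \<in> F" for x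
    using fl_le_Om[OF that] True unfolding ovf_def by linarith
  then have "realizable n (\<lambda>B. rd (l B + (- c))) (\<lambda>B. rd (h B + (- c)))"
    using assms realizable_fl[OF assms(1)] by (intro realizable_add realizable_const) auto
  then show ?thesis using that[of "\<lambda>x. rd (x + (- c))"] rd_diff_nonneg_iff assms(2) by simp
next
  case False
  have c2: "c / 2 \<in> F" using half_fl assms False by simp
  have "2 powi (emin E + 1) \<le> Om" using False fl_le_Om[OF assms(2)] by linarith
  then have Om2: "Om / 2 \<in> F" using half_fl Om_fl by simp
  \<comment> \<open>After halving, both terms have size at most \<open>Om / 2\<close>, so their sum
    stays within \<open>Om\<close>.\<close>
  have bound: "\<bar>rd (1 / 2 * x) + (- (c / 2))\<bar> < ovf" if "x \<in> F" for x
  proof -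
    have "- (Om / 2) \<le> 1 / 2 * x" "1 / 2 * x \<le> Om / 2"
      using fl_le_Om[OF that] by linarith+
    then have "- (Om / 2) \<le> rd (1 / 2 * x)" "rd (1 / 2 * x) \<le> Om / 2"
      using rd_ge[OF _ fl_uminus[THEN iffD2, OF Om2]] rd_le[OF _ Om2] by blast+
    then show ?thesis using fl_le_Om[OF assms(2)] by (intro less_ovf) linarith
  qed
  have "\<bar>1 / 2 * x\<bar> \<le> Om" if "x \<in> F" for x
    using fl_le_Om[OF that] by linarith
  then have "realizable n (\<lambda>B. rd (rd (1 / 2 * l B) + (- (c / 2)))) (\<lambda>B. rd (rd (1 / 2 * h B) + (- (c / 2))))"
    using bound realizable_fl[OF assms(1)] c2 small_fl
    by (intro realizable_add realizable_scale realizable_const assms) auto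
  then show ?thesis
    using that[of "\<lambda>x. rd (rd (1 / 2 * x) + (- (c / 2)))"] rd_diff_nonneg_iff[of _ "c / 2"]
      rd_half_ge_iff c2 assms(2) False by simp
qed

lemma indicates_ge:
  assumes "realizable n l h" "c \<in> F"
  shows "indicates n (\<lambda>B. c \<le> l B) (\<lambda>B. c \<le> h B)"
proof -
  obtain f where f: "realizable n (\<lambda>B. f (l B)) (\<lambda>B. f (h B))" "\<And>x. x \<in> F \<Longrightarrow> 0 \<le> f x \<longleftrightarrow> c \<le> x"
    using realizable_compare[OF assms] by blast
  obtain N where N: "\<And>y. y \<in> F \<Longrightarrow> (shrink ^^ N) y = sgn y * w" using shrink_iter by blast
  have "realizable n (\<lambda>B. (shrink ^^ k) (f (l B))) (\<lambda>B. (shrink ^^ k) (f (h B)))" for k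
  proof (induction k)
    case (Suc k)
    have "\<bar>5 / 8 * x\<bar> \<le> Om" if "x \<in> F" for x using fl_le_Om[OF that] by (simp add: abs_mult)
    then show ?case using realizable_scale[OF Suc, of "5/8"] realizable_fl[OF Suc] small_fl
      by (simp add: shrink_def)
  qed (use f in simp)
  from realizable_cong[OF this, of N "\<lambda>B. sgn (f (l B)) * w" "\<lambda>B. sgn (f (h B)) * w"]
  have "realizable n (\<lambda>B. sgn (f (l B)) * w) (\<lambda>B. sgn (f (h B)) * w)"
    using N realizable_fl[OF f(1)] by simp
  \<comment> \<open>Adding \<open>w\<close> turns \<open>- w\<close>, \<open>0\<close>,
    \<open>w\<close> into \<open>0\<close>, \<open>w\<close>, \<open>2 * w\<close>; the factor
    \<open>5/8\<close> then merges the last two, which are the nonnegative signs.\<close>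
  then have "realizable n (\<lambda>B. rd (5 / 8 * rd (sgn (f (l B)) * w + w))) (\<lambda>B. rd (5 / 8 * rd (sgn (f (h B)) * w + w)))"
    using small_fl by (intro add_scale_realizable realizable_const) (auto simp: sgn_if)
  moreover have "rd (5 / 8 * rd (sgn y * w + w)) = (if 0 \<le> y then w else 0)" for y
    using rd_or[of False True] rd_or[of True True] rd_or[of False False] by (auto simp: sgn_if)
  ultimately show ?thesis
    unfolding indicates_def using f(2) realizable_fl[OF assms(1)] by (elim realizable_cong) simp
qed

section \<open>Indicators of sets and the hull of a function\<close>


definition points :: "itv list \<Rightarrow> real list set" where
  "points B = {xs. length xs = length B \<and>
     (\<forall>i<length B. xs ! i \<in> F \<and> lo (B ! i) \<le> xs ! i \<and> xs ! i \<le> hi (B ! i))}"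

lemma length_fboxes: "B \<in> fboxes n \<Longrightarrow> length B = n"
  by (simp add: fboxes_def)

lemma finite_points: "finite (points B)"
proof (rule finite_subset)
  show "points B \<subseteq> {xs. set xs \<subseteq> F \<and> length xs = length B}"
    by (auto simp: points_def in_set_conv_nth)
qed (rule finite_lists_length_eq[OF finite_fl])

lemma points_nonempty:
  assumes "B \<in> fboxes n" shows "points B \<noteq> {}"
proof -
  have "map lo B \<in> points B"
    using fboxes_nth[OF assms] length_fboxes[OF assms] by (simp add: points_def)
  then show ?thesis by blast
qed

definition point_box :: "real list \<Rightarrow> itv list" where
  "point_box xs = map (\<lambda>x. Itv (ereal x) (ereal x)) xs"

lemma point_box_fboxes: "set xs \<subseteq> F \<Longrightarrow> point_box xs \<in> fboxes (length xs)"
  by (auto simp: point_box_def fboxes_def)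

lemma points_point_box: "set xs \<subseteq> F \<Longrightarrow> points (point_box xs) = {xs}"
  by (auto simp: points_def point_box_def intro!: nth_equalityI)

text \<open>The lower end tests whether \<open>B\<close> lies inside \<open>D\<close>, the upper end
  whether they meet, which for boxes is decided coordinatewise. Negating inputs turns upper bounds
  into the \<open>\<ge>\<close> tests available.\<close>

lemma indicates_box:
  assumes "D \<in> fboxes n"
  shows "indicates n (\<lambda>B. \<forall>i<n. lo (D ! i) \<le> lo (B ! i) \<and> - hi (D ! i) \<le> - hi (B ! i))
    (\<lambda>B. \<forall>i<n. lo (D ! i) \<le> hi (B ! i) \<and> - hi (D ! i) \<le> - lo (B ! i))"
  using fboxes_nth[OF assms]
  by (intro indicates_all indicates_and indicates_ge realizable_uminus realizable_input) auto

text \<open>A set is the union of the boxes it contains. A box that lies in the set is itself one of them,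
  hence the lower bounds of the disjunction are exact; one that meets the set contains one of its
  points, which is a box as well, hence the upper bounds are.\<close>
lemma indicates_set: "indicates n (\<lambda>B. points B \<subseteq> A) (\<lambda>B. points B \<inter> A \<noteq> {})"
proof -
  let ?S = "{D \<in> fboxes n. points D \<subseteq> A}"
  have "indicates n
    (\<lambda>B. \<exists>D\<in>?S. \<forall>i<n. lo (D ! i) \<le> lo (B ! i) \<and> - hi (D ! i) \<le> - hi (B ! i))
    (\<lambda>B. \<exists>D\<in>?S. \<forall>i<n. lo (D ! i) \<le> hi (B ! i) \<and> - hi (D ! i) \<le> - lo (B ! i))"
    using finite_fboxes by (intro indicates_ex indicates_box) auto
  then show ?thesis
  proof (rule indicates_cong, intro conjI iffI)
    fix B assume B: "B \<in> fboxes n"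
    note [simp] = length_fboxes[OF B]
    show "points B \<subseteq> A"
      if "\<exists>D\<in>?S. \<forall>i<n. lo (D ! i) \<le> lo (B ! i) \<and> - hi (D ! i) \<le> - hi (B ! i)"
    proof -
      from that obtain D where D: "D \<in> fboxes n" "points D \<subseteq> A"
        "\<forall>i<n. lo (D ! i) \<le> lo (B ! i) \<and> hi (B ! i) \<le> hi (D ! i)" by auto
      have "points B \<subseteq> points D"
        unfolding points_def using D(3) length_fboxes[OF D(1)] by fastforce
      then show ?thesis using D(2) by blast
    qed
    show "\<exists>D\<in>?S. \<forall>i<n. lo (D ! i) \<le> lo (B ! i) \<and> - hi (D ! i) \<le> - hi (B ! i)" if "points B \<subseteq> A"
      using that B by (intro bexI[of _ B]) auto
    show "points B \<inter> A \<noteq> {}"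
      if "\<exists>D\<in>?S. \<forall>i<n. lo (D ! i) \<le> hi (B ! i) \<and> - hi (D ! i) \<le> - lo (B ! i)"
    proof -
      from that obtain D where D: "D \<in> fboxes n" "points D \<subseteq> A"
        "\<forall>i<n. lo (D ! i) \<le> hi (B ! i) \<and> lo (B ! i) \<le> hi (D ! i)" by auto
      let ?xs = "map (\<lambda>i. max (lo (D ! i)) (lo (B ! i))) [0..<n]"
      have "?xs \<in> points B" "?xs \<in> points D"
        using D(3) fboxes_nth[OF D(1)] fboxes_nth[OF B] length_fboxes[OF D(1)]
        by (auto simp: points_def max_def)
      then show ?thesis using D(2) by blast
    qed
    show "\<exists>D\<in>?S. \<forall>i<n. lo (D ! i) \<le> hi (B ! i) \<and> - hi (D ! i) \<le> - lo (B ! i)" if "points B \<inter> A \<noteq> {}"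
    proof -
      from that obtain xs where xs: "xs \<in> points B" "xs \<in> A" by blast
      then have "set xs \<subseteq> F" "length xs = n" by (auto simp: points_def in_set_conv_nth)
      then have "point_box xs \<in> ?S" using point_box_fboxes points_point_box xs(2) by force
      then show ?thesis using xs(1) \<open>length xs = n\<close>
        by (intro bexI[of _ "point_box xs"]) (auto simp: points_def point_box_def)
    qed
  qed
qed

section \<open>Rebuilding values from indicators\<close>

lemma indicates_scale:
  assumes "indicates n p q" "qmin \<le> k" "k \<le> emax E"
  shows "realizable n (\<lambda>B. if p B then 2 powi k else 0) (\<lambda>B. if q B then 2 powi k else 0)"
  using assms(2,3)
\<comment> \<open>The scaling is done by repeated doubling, since the single factor
  \<open>2 powi (k - qmin)\<close> may be too large to be a float.\<close>
proof (induction k rule: int_ge_induct)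
  case base
  show ?case using assms(1) unfolding indicates_def w_def .
next
  case (step k)
  have *: "2 * (if P then 2 powi k else 0) = (if P then 2 powi (k + 1) else (0::real))" for P
    by (simp add: power_int_add)
  have fl: "(if P then 2 powi (k + 1) else 0) \<in> F" for P
    using pow2_fl[of "k + 1"] step by simp
  have "\<bar>2 * (if P then 2 powi k else 0)\<bar> \<le> Om" for P
    unfolding * by (rule fl_le_Om[OF fl])
  then have "realizable n (\<lambda>B. rd (2 * (if p B then 2 powi k else 0))) (\<lambda>B. rd (2 * (if q B then 2 powi k else 0)))"
    using step small_fl by (intro realizable_scale) auto
  then show ?case unfolding * rd_id[OF fl] .
qed

text \<open>Truncation to the range from \<open>- Om\<close> to \<open>v\<close>, for
  \<open>v\<close> in \<open>F\<close>; at \<open>v = Om\<close> it changes only the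
  infinities.\<close>

definition clamp :: "real \<Rightarrow> ereal \<Rightarrow> real" where
  "clamp v r = (if ereal v \<le> r then v else if r \<le> ereal (- Om) then - Om else real_of_ereal r)"

text \<open>No value of \<open>r\<close> lies strictly between \<open>u\<close> and
  \<open>v\<close>, so raising the cap matters only when \<open>r\<close> reaches
  \<open>v\<close>.\<close>

lemma clamp_step:
  assumes "u \<in> F" "v \<in> F" "u < v" and gap: "\<And>f. f \<in> F \<Longrightarrow> u < f \<Longrightarrow> v \<le> f" and "r \<in> flx E M"
  shows "clamp v r = clamp u r + (if ereal v \<le> r then v - u else 0)"
proof (cases "ereal v \<le> r")
  case True
  then have "ereal u \<le> r" using assms(3) by (metis ereal_less_eq(3) less_imp_le order_trans)
  then show ?thesis using True by (simp add: clamp_def)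
next
  case False
  have "- Om \<le> u" using fl_le_Om[OF assms(1)] by linarith
  then show ?thesis using False assms(5) gap
    by (cases r) (force simp: clamp_def flx_def)+
qed

text \<open>The cap climbs through the floats from \<open>- Om\<close>. Each increment is an
  indicator scaled to a power of two, and each partial sum is again a truncation with values in
  \<open>F\<close>, so no addition rounds.\<close>

lemma realizable_clamp:
  assumes mm: "\<And>B. B \<in> fboxes n \<Longrightarrow> mn B \<in> flx E M \<and> mx B \<in> flx E M"
    and ind: "\<And>v. indicates n (\<lambda>B. v \<le> mn B) (\<lambda>B. v \<le> mx B)"
    and "v \<in> F"
  shows "realizable n (\<lambda>B. clamp v (mn B)) (\<lambda>B. clamp v (mx B))"
  using assms(3)
proof (induction "card {f \<in> F. f < v}" arbitrary: v rule: less_induct)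
  case less
  let ?L = "{f \<in> F. f < v}"
  show ?case
  proof (cases "?L = {}")
    case True
    have "- Om \<in> F" using Om_fl by simp
    then have "\<not> - Om < v" using True by blast
    then have "v = - Om" using fl_le_Om[OF less.prems] by linarith
    then have "clamp v r = - Om" for r using linear[of "ereal (- Om)" r] by (auto simp: clamp_def)
    then show ?thesis using \<open>- Om \<in> F\<close> by (simp add: realizable_const)
  next
    case False
    define u where "u = Max ?L"
    have fin: "finite ?L" using finite_fl by simp
    have u: "u \<in> F" "u < v" using Max_in[OF fin False] by (auto simp: u_def)
    have gap: "v \<le> f" if "f \<in> F" "u < f" for f
      using Max_ge[OF fin, of f] that by (force simp: u_def)
    obtain q where "v = u + 2 powi q" and q': "qmin \<le> q" "q \<le> qmax"
      using fl_adjacent[OF u(1) less.prems u(2) gap] by blast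
    then have q: "v - u = 2 powi q" by simp
    have "{f \<in> F. f < u} \<subset> ?L" using u by auto
    then have cu: "realizable n (\<lambda>B. clamp u (mn B)) (\<lambda>B. clamp u (mx B))"
      using fin u by (intro less.hyps psubset_card_mono)
    let ?d = "\<lambda>r. if ereal v \<le> r then v - u else 0"
    have d: "realizable n (\<lambda>B. ?d (mn B)) (\<lambda>B. ?d (mx B))"
      unfolding q using q' by (intro indicates_scale ind) (auto simp: qmax_def)
    have step: "\<bar>clamp u r + ?d r\<bar> < ovf" "rd (clamp u r + ?d r) = clamp v r" if "r \<in> flx E M" for r
    proof -
      have eq: "clamp u r + ?d r = clamp v r"
        using clamp_step[OF u(1) less.prems u(2) gap that] by simp
      have "clamp v r \<in> F"
        using that less.prems Om_fl by (auto simp: clamp_def flx_def)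
      then show "\<bar>clamp u r + ?d r\<bar> < ovf" "rd (clamp u r + ?d r) = clamp v r"
        unfolding eq by (simp_all add: less_ovf fl_le_Om)
    qed
    have "realizable n (\<lambda>B. rd (clamp u (mn B) + ?d (mn B))) (\<lambda>B. rd (clamp u (mx B) + ?d (mx B)))"
      using mm step(1) by (intro realizable_add cu d) blast
    then show ?thesis using mm step(2) by (elim realizable_cong) blast
  qed
qed

text \<open>A final overflow in \<open>z \<oplus> s\<close> with finite \<open>z\<close> and \<open>s \<in> {- 2 powi emax, 0, 2 powi emax}\<close>
  produces the infinite outputs, so that \<open>\<infinity> - \<infinity>\<close> never occurs, even on boxes where both
  infinities are attained.\<close>
lemma realize_hull:
  assumes mm: "\<And>B. B \<in> fboxes n \<Longrightarrow> mn B \<in> flx E M \<and> mx B \<in> flx E M \<and> mn B \<le> mx B"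
    and ind: "\<And>v. indicates n (\<lambda>B. v \<le> mn B) (\<lambda>B. v \<le> mx B)"
  shows "\<exists>e. expr_ok E M n e \<and> (\<forall>B \<in> fboxes n. itv_val B e = Itv (mn B) (mx B))"
proof -
  let ?T = "2 powi emax E :: real"
  have qmin_emax: "qmin \<le> emax E" using qmin_le emax_ge by simp
  have T: "?T \<in> F" "- ?T \<in> F" using pow2_fl[OF qmin_emax] by simp_all
  have T_ovf: "?T < ovf" using less_ovf[OF fl_le_Om[OF T(1)]] by simp
  \<comment> \<open>The start value \<open>- ?T\<close> encodes \<open>- \<infinity>\<close>; it is
    cancelled once \<open>r\<close> reaches \<open>- Om\<close>, and \<open>?T\<close> is added only
    at \<open>\<infinity>\<close>.\<close>
  define s where "s r = rd (rd (- ?T + (if ereal (- Om) \<le> r then ?T else 0)) + (if \<infinity> \<le> r then ?T else 0))" for r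
  have s: "s r = (if r = \<infinity> then ?T else if r = - \<infinity> then - ?T else 0)" if "r \<in> flx E M" for r
  proof (cases "r = \<infinity> \<or> r = - \<infinity>")
    case True
    then show ?thesis using T by (auto simp: s_def)
  next
    case False
    then obtain x where "r = ereal x" "x \<in> F" using \<open>r \<in> _\<close> by (auto simp: flx_def)
    then show ?thesis using fl_le_Om[of x] by (simp add: s_def)
  qed
  have bound: "\<bar>- ?T + (if a then ?T else 0)\<bar> < ovf" "rd (- ?T + (if a then ?T else 0)) = - ?T + (if a then ?T else 0)" for a
    using T T_ovf ovf_pos by auto
  have "\<bar>- ?T + (if a then ?T else 0) + (if b then ?T else 0)\<bar> < ovf" for a b
    using T_ovf ovf_pos by auto
  then have sr: "realizable n (\<lambda>B. s (mn B)) (\<lambda>B. s (mx B))"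
    unfolding s_def using T bound qmin_emax
    by (intro realizable_add realizable_const indicates_scale ind) simp_all
  have zr: "realizable n (\<lambda>B. clamp Om (mn B)) (\<lambda>B. clamp Om (mx B))"
    using mm ind Om_fl by (intro realizable_clamp) auto
  have ovf: "ovf \<le> Om + ?T"
  proof -
    have "2 powi (qmax - 1) \<le> ?T" by (intro power_int_increasing) (auto simp: qmax_def)
    then show ?thesis by (simp add: ovf_def)
  qed
  have final: "rdx (clamp Om r + s r) = r" if r: "r \<in> flx E M" for r
  proof (cases "r = \<infinity> \<or> r = - \<infinity>")
    case True
    then show ?thesis using ovf ovf_pos s[OF r] by (auto simp: rdx_def clamp_def)
  next
    case False
    then obtain x where x: "r = ereal x" "x \<in> F" using r by (auto simp: flx_def)
    then have "clamp Om r = x" using fl_le_Om[of x] by (auto simp: clamp_def)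
    then show ?thesis using x s[OF r] less_ovf[OF fl_le_Om[OF x(2)]] by (simp add: rdx_eq)
  qed
  obtain z where z: "expr_ok E M n z"
    "\<forall>B \<in> fboxes n. itv_val B z = Itv (ereal (clamp Om (mn B))) (ereal (clamp Om (mx B))) \<and> clamp Om (mn B) \<le> clamp Om (mx B)"
    using zr by (rule realizableE)
  obtain t where t: "expr_ok E M n t"
    "\<forall>B \<in> fboxes n. itv_val B t = Itv (ereal (s (mn B))) (ereal (s (mx B))) \<and> s (mn B) \<le> s (mx B)"
    using sr by (rule realizableE)
  have "itv_val B (Op Add z t) = Itv (mn B) (mx B)" if "B \<in> fboxes n" for B
    using z(2)[rule_format, OF that] t(2)[rule_format, OF that] mm[OF that]
    by (simp add: iop_fadd final del: iop.simps)
  then show ?thesis using z(1) t(1) by (intro exI[of _ "Op Add z t"]) simp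
qed

text \<open>The minimum over a box is at least \<open>v\<close> when the box lies in the level set
  \<open>{xs. v \<le> f xs}\<close>, the maximum when it meets that set;
  \<open>indicates_set\<close> decides both.\<close>

lemma realize_function:
  assumes "\<And>xs. length xs = n \<Longrightarrow> set xs \<subseteq> F \<Longrightarrow> f xs \<in> flx E M"
  shows "\<exists>e. expr_ok E M n e \<and>
    (\<forall>B \<in> fboxes n. itv_val B e = Itv (Min (f ` points B)) (Max (f ` points B)))"
proof (rule realize_hull)
  have fin: "finite (f ` points B)" for B using finite_points by blast
  have ne: "f ` points B \<noteq> {}" if "B \<in> fboxes n" for B using points_nonempty[OF that] by blast
  show "Min (f ` points B) \<in> flx E M \<and> Max (f ` points B) \<in> flx E M \<and> Min (f ` points B) \<le> Max (f ` points B)"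
    if "B \<in> fboxes n" for B
  proof -
    have "f ` points B \<subseteq> flx E M"
      using assms length_fboxes[OF that] by (auto simp: points_def in_set_conv_nth subset_iff)
    then show ?thesis
      using Min_in[OF fin ne[OF that]] Max_in[OF fin ne[OF that]] Min_le[OF fin Max_in[OF fin ne[OF that]]]
      by blast
  qed
  fix v
  show "indicates n (\<lambda>B. v \<le> Min (f ` points B)) (\<lambda>B. v \<le> Max (f ` points B))"
  proof (rule indicates_cong[OF indicates_set[of n "{xs. v \<le> f xs}"]])
    fix B assume "B \<in> fboxes n"
    then show "(points B \<subseteq> {xs. v \<le> f xs}) = (v \<le> Min (f ` points B)) \<and>
      (points B \<inter> {xs. v \<le> f xs} \<noteq> {}) = (v \<le> Max (f ` points B))"
      using fin ne by (auto simp: Min_ge_iff Max_ge_iff)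
  qed
qed

end

section \<open>Assembly of the program and its concrete semantics\<close>

theorem theorem3:
  fixes E M n m :: nat and P :: "real list \<Rightarrow> ereal list"
  assumes "E \<ge> 5" and "M \<ge> 3" and "2 ^ (E - 1) \<ge> M"
    and "\<forall>xs. length xs = n \<and> set xs \<subseteq> fl E M \<longrightarrow> length (P xs) = m \<and> set (P xs) \<subseteq> flx E M"
  shows "\<exists>p. wf_prog E M n m p \<and>
    (\<forall>B. length B = n \<and> set B \<subseteq> itvs E M \<and>
         (\<forall>i<n. gamma E M (B ! i) \<subseteq> Val ` ereal ` fl E M) \<longrightarrow>
       (\<forall>j<m. gamma E M (Qa E M p B ! j) =
          {v \<in> Fbar E M. \<exists>r. v = Val r \<and>
             Min {P xs ! j | xs. length xs = n \<and> (\<forall>i<n. Val (ereal (xs ! i)) \<in> gamma E M (B ! i))} \<le> r \<and>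
             r \<le> Max {P xs ! j | xs. length xs = n \<and> (\<forall>i<n. Val (ereal (xs ! i)) \<in> gamma E M (B ! i))}})) \<and>
    (\<forall>xs. length xs = n \<and> set xs \<subseteq> fl E M \<longrightarrow> Qc E M p xs = map Val (P xs))"
proof -
  interpret float_format E M using assms(1-3) by unfold_locales
  define exact where "exact j e \<longleftrightarrow> expr_ok E M n e \<and> (\<forall>B \<in> fboxes n.
      itv_val B e = Itv (Min ((\<lambda>xs. P xs ! j) ` points B)) (Max ((\<lambda>xs. P xs ! j) ` points B)))" for j e
  have exact_ex: "\<exists>e. exact j e" if "j < m" for j
    unfolding exact_def using that assms(4) by (intro realize_function) force
  define ex where "ex j = (SOME e. exact j e)" for j
  have exact: "exact j (ex j)" if "j < m" for j
    unfolding ex_def using someI_ex[OF exact_ex[OF that]] .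
  have ex: "expr_ok E M n (ex j)"
    "B \<in> fboxes n \<Longrightarrow> itv_val B (ex j) =
       Itv (Min ((\<lambda>xs. P xs ! j) ` points B)) (Max ((\<lambda>xs. P xs ! j) ` points B))" if "j < m" for j B
    using exact[OF that] unfolding exact_def by simp_all
  obtain p where "wf_prog E M n (length (map ex [0..<m])) p"
    and run: "\<And>B. run (\<lambda>f. iop (fop E M f)) (\<lambda>c. Itv (ereal c) (ereal c)) p B = map (itv_val B) (map ex [0..<m])"
    using compile_exprs[of "map ex [0..<m]" E M n] ex(1) by fastforce
  then have wf: "wf_prog E M n m p" by simp
  have Qa: "Qa E M p B = map (\<lambda>j. itv_val B (ex j)) [0..<m]" for B
    unfolding Qa_def run by simp
  have box: "B \<in> fboxes n \<and>
      points B = {xs. length xs = n \<and> (\<forall>i<n. Val (ereal (xs ! i)) \<in> gamma E M (B ! i))}"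
    if B: "length B = n" "set B \<subseteq> itvs E M" "\<forall>i<n. gamma E M (B ! i) \<subseteq> Val ` ereal ` fl E M" for B
  proof -
    have nth: "\<exists>l u. B ! i = Itv (ereal l) (ereal u) \<and> l \<in> F \<and> u \<in> F \<and> l \<le> u" if "i < n" for i
    proof -
      have "B ! i \<in> itvs E M" using B that nth_mem by blast
      moreover have sub: "gamma E M (B ! i) \<subseteq> Val ` ereal ` F" using B(3) that by blast
      \<comment> \<open>The concretization of \<open>Top\<close> contains
        \<open>NaN\<close>.\<close>
      moreover have "B ! i \<noteq> Top" using sub by (auto simp: Fbar_def)
      ultimately obtain a b where ab: "B ! i = Itv a b" "a \<in> flx E M" "b \<in> flx E M" "a \<le> b"
        by (auto simp: itvs_def)
      \<comment> \<open>Both ends belong to the concretization of their interval, which excludes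
        infinite ends.\<close>
      then have "Val a \<in> Val ` ereal ` F" "Val b \<in> Val ` ereal ` F" using sub by auto
      then show ?thesis using ab by auto
    qed
    then have "B \<in> fboxes n" using B(1) by (auto simp: fboxes_def in_set_conv_nth)
    moreover have "Val (ereal x) \<in> gamma E M (B ! i) \<longleftrightarrow> x \<in> F \<and> lo (B ! i) \<le> x \<and> x \<le> hi (B ! i)"
      if "i < n" for i x
      using nth[OF that] by (auto simp: flx_def)
    ultimately show ?thesis using B(1) by (auto simp: points_def)
  qed
  have "gamma E M (Qa E M p B ! j) = {v \<in> Fbar E M. \<exists>r. v = Val r \<and>
       Min {P xs ! j | xs. length xs = n \<and> (\<forall>i<n. Val (ereal (xs ! i)) \<in> gamma E M (B ! i))} \<le> r \<and>
       r \<le> Max {P xs ! j | xs. length xs = n \<and> (\<forall>i<n. Val (ereal (xs ! i)) \<in> gamma E M (B ! i))}}"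
    if B: "length B = n" "set B \<subseteq> itvs E M" "\<forall>i<n. gamma E M (B ! i) \<subseteq> Val ` ereal ` fl E M"
      and j: "j < m" for B j
  proof -
    let ?X = "{P xs ! j | xs. length xs = n \<and> (\<forall>i<n. Val (ereal (xs ! i)) \<in> gamma E M (B ! i))}"
    have "?X = (\<lambda>xs. P xs ! j) ` points B" using box[OF B] by auto
    then have "Qa E M p B ! j = Itv (Min ?X) (Max ?X)" using Qa ex(2) j box[OF B] by simp
    then show ?thesis by (auto simp: Fbar_def)
  qed
  moreover have "Qc E M p xs = map Val (P xs)" if xs: "length xs = n" "set xs \<subseteq> F" for xs
  proof (rule nth_equalityI)
    \<comment> \<open>On the point box of \<open>xs\<close> the hull of each output degenerates to
      the value of \<open>P\<close>, which fixes the concrete result and rules out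
      \<open>NaN\<close>.\<close>
    have eq: "map sing (Qc E M p xs) = map (\<lambda>j. itv_val (point_box xs) (ex j)) [0..<m]"
      using Qa_sing[OF wf xs(1)] Qa by (simp add: point_box_def)
    then show len: "length (Qc E M p xs) = length (map Val (P xs))"
      using assms(4) xs by (metis length_map length_upt minus_nat.diff_0)
    fix j assume "j < length (Qc E M p xs)"
    then have j: "j < m" "j < length (P xs)" using len assms(4) xs by auto
    have "sing (Qc E M p xs ! j) = itv_val (point_box xs) (ex j)"
      using arg_cong[OF eq, of "\<lambda>vs. vs ! j"] len j by simp
    also have "\<dots> = Itv (P xs ! j) (P xs ! j)"
      using ex(2)[OF j(1) point_box_fboxes[OF xs(2), unfolded xs(1)]] points_point_box[OF xs(2)] by simp
    finally show "Qc E M p xs ! j = map Val (P xs) ! j" using sing_inject j by simp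
  qed
  ultimately show ?thesis using wf by blast
qed

end
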